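(* Let $X$ be a sublattice of a uniformly complete vector lattice $Z$. Define subsets $X_\kappa$ of $Z$ for ordinals $\kappa$ by transfinite recursion: $X_0=X$; $X_{\kappa+1}$ is the set of all uniform limits in $Z$ of sequences in $X_\kappa$ with regulators in $X_\kappa$, i.e., the set of all $z\in Z$ for which there exist a sequence $(x_n)$ in $X_\kappa$ and $e\in X_\kappa$, $e\ge 0$, such that $(x_n)$ converges to $z$ uniformly relative to $e$; and $X_\kappa=\bigcup_{\iota<\kappa}X_\iota$ if $\kappa$ is a limit ordinal. Then the process stabilizes after $\omega_1$ steps, i.e., $X_\kappa=X_{\omega_1}$ for all $\kappa\ge\omega_1$, and $X_{\omega_1}$ is (a sublattice of $Z$) lattice isomorphic to the uniform completion $X^{\mathrm{ru}}$ of $X$ via an isomorphism which is the identity on $X$.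
   Context: All vector lattices are real and Archimedean. For a vector lattice $Z$ and $e\in Z_+$, a net $(x_\alpha)$ in $Z$ converges to $x\in Z$ uniformly relative to $e$ if for every $\varepsilon>0$ there is $\alpha_0$ with $|x_\alpha-x|\le\varepsilon e$ for all $\alpha\ge\alpha_0$; $e$ is then called a regulator of the convergence; the net converges (relatively) uniformly to $x$ in $Z$ if this holds for some $e\in Z_+$. A net $(x_\alpha)_{\alpha\in\Lambda}$ is uniformly Cauchy in $Z$ if the net $(x_\alpha-x_\beta)$ indexed by $\Lambda^2$ converges uniformly to $0$ in $Z$. $Z$ is uniformly complete if every uniformly Cauchy net in $Z$ converges uniformly in $Z$. $X^\delta$ denotes the order (Dedekind) completion of $X$. The uniform completion $X^{\mathrm{ru}}$ of $X$ is the intersection of all sublattices of $X^\delta$ that contain $X$ and are uniformly complete as vector lattices (it is itself such a sublattice). $\omega_1$ is the first uncountable ordinal. *)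

theory Defs
  imports
    Complex_Main
    "HOL-Library.Lattice_Algebras"
    "HOL-Library.Countable_Set_Type"
begin

section \<open>Vector lattices and relative uniform convergence\<close>

class archimedean_vector_lattice = ordered_real_vector + lattice_ab_group_add_abs +
  assumes archimedean: "(\<And>n::nat. real n *\<^sub>R x \<le> y) \<Longrightarrow> x \<le> 0"

definition vector_sublattice :: "'a::archimedean_vector_lattice set \<Rightarrow> bool" where
  "vector_sublattice Y \<longleftrightarrow> subspace Y \<and> (\<forall>x\<in>Y. \<forall>y\<in>Y. sup x y \<in> Y \<and> inf x y \<in> Y)"

definition directed_set :: "'i set \<Rightarrow> ('i \<Rightarrow> 'i \<Rightarrow> bool) \<Rightarrow> bool" where
  "directed_set \<Lambda> le \<longleftrightarrow> \<Lambda> \<noteq> {} \<and> (\<forall>\<alpha>\<in>\<Lambda>. le \<alpha> \<alpha>) \<and>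
     (\<forall>\<alpha>\<in>\<Lambda>. \<forall>\<beta>\<in>\<Lambda>. \<forall>\<gamma>\<in>\<Lambda>. le \<alpha> \<beta> \<longrightarrow> le \<beta> \<gamma> \<longrightarrow> le \<alpha> \<gamma>) \<and>
     (\<forall>\<alpha>\<in>\<Lambda>. \<forall>\<beta>\<in>\<Lambda>. \<exists>\<gamma>\<in>\<Lambda>. le \<alpha> \<gamma> \<and> le \<beta> \<gamma>)"

definition converges_rel ::
  "'i set \<Rightarrow> ('i \<Rightarrow> 'i \<Rightarrow> bool) \<Rightarrow> ('i \<Rightarrow> 'a::archimedean_vector_lattice) \<Rightarrow> 'a \<Rightarrow> 'a \<Rightarrow> bool" where
  "converges_rel \<Lambda> le x l e \<longleftrightarrow>
     (\<forall>\<epsilon>>0. \<exists>\<alpha>\<^sub>0\<in>\<Lambda>. \<forall>\<alpha>\<in>\<Lambda>. le \<alpha>\<^sub>0 \<alpha> \<longrightarrow> \<bar>x \<alpha> - l\<bar> \<le> \<epsilon> *\<^sub>R e)"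

text \<open>
  In the following three definitions \<open>Y\<close> is a sublattice, regarded as a vector lattice in its
  own right: both the limit and the regulator have to lie in \<open>Y\<close>.
\<close>

definition converges_uniformly_in ::
  "'a::archimedean_vector_lattice set \<Rightarrow> 'i set \<Rightarrow> ('i \<Rightarrow> 'i \<Rightarrow> bool) \<Rightarrow> ('i \<Rightarrow> 'a) \<Rightarrow> 'a \<Rightarrow> bool" where
  "converges_uniformly_in Y \<Lambda> le x l \<longleftrightarrow> l \<in> Y \<and> (\<exists>e\<in>Y. 0 \<le> e \<and> converges_rel \<Lambda> le x l e)"

definition uniformly_Cauchy_in ::
  "'a::archimedean_vector_lattice set \<Rightarrow> 'i set \<Rightarrow> ('i \<Rightarrow> 'i \<Rightarrow> bool) \<Rightarrow> ('i \<Rightarrow> 'a) \<Rightarrow> bool" where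
  "uniformly_Cauchy_in Y \<Lambda> le x \<longleftrightarrow>
     converges_uniformly_in Y (\<Lambda> \<times> \<Lambda>)
       (\<lambda>p q. le (fst p) (fst q) \<and> le (snd p) (snd q)) (\<lambda>p. x (fst p) - x (snd p)) 0"

text \<open>
  A definition cannot quantify over all index types. The type \<^typ>\<open>'a set \<times> 'a\<close> is large enough
  to index nets in \<^typ>\<open>'a\<close> by the elements of their tails; lemma \<open>uniformly_completeD\<close>
  below shows that nets over every other index type are covered as well.
\<close>

definition uniformly_complete :: "'a::archimedean_vector_lattice set \<Rightarrow> bool" where
  "uniformly_complete Y \<longleftrightarrow>
     (\<forall>(\<Lambda> :: ('a set \<times> 'a) set) le x. directed_set \<Lambda> le \<longrightarrow> (\<forall>\<alpha>\<in>\<Lambda>. x \<alpha> \<in> Y) \<longrightarrow>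
        uniformly_Cauchy_in Y \<Lambda> le x \<longrightarrow> (\<exists>l. converges_uniformly_in Y \<Lambda> le x l))"

lemma uniformly_completeD:
  fixes Y :: "'a::archimedean_vector_lattice set" and \<Lambda> :: "'i set"
  assumes Y: "uniformly_complete Y" and dir: "directed_set \<Lambda> le"
    and xY: "\<forall>\<alpha>\<in>\<Lambda>. x \<alpha> \<in> Y" and Cau: "uniformly_Cauchy_in Y \<Lambda> le x"
  shows "\<exists>l. converges_uniformly_in Y \<Lambda> le x l"
proof -
  define T where "T \<alpha> = x ` {\<beta>\<in>\<Lambda>. le \<alpha> \<beta>}" for \<alpha>
  define \<Lambda>' where "\<Lambda>' = {(T \<alpha>, y) | \<alpha> y. \<alpha> \<in> \<Lambda> \<and> y \<in> T \<alpha>}"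
  define le' where "le' p q \<longleftrightarrow> fst q \<subseteq> fst p" for p q :: "'a set \<times> 'a"
  have ne: "\<Lambda> \<noteq> {}" and refl: "\<And>\<alpha>. \<alpha> \<in> \<Lambda> \<Longrightarrow> le \<alpha> \<alpha>"
    and tr: "\<And>\<alpha> \<beta> \<gamma>. \<lbrakk>\<alpha> \<in> \<Lambda>; \<beta> \<in> \<Lambda>; \<gamma> \<in> \<Lambda>; le \<alpha> \<beta>; le \<beta> \<gamma>\<rbrakk> \<Longrightarrow> le \<alpha> \<gamma>"
    and ub: "\<And>\<alpha> \<beta>. \<lbrakk>\<alpha> \<in> \<Lambda>; \<beta> \<in> \<Lambda>\<rbrakk> \<Longrightarrow> \<exists>\<gamma>\<in>\<Lambda>. le \<alpha> \<gamma> \<and> le \<beta> \<gamma>"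
    using dir unfolding directed_set_def by blast+
  have self: "x \<alpha> \<in> T \<alpha>" if "\<alpha> \<in> \<Lambda>" for \<alpha>
    using that refl[OF that] unfolding T_def by blast
  have in': "(T \<alpha>, x \<beta>) \<in> \<Lambda>'" if "\<alpha> \<in> \<Lambda>" "\<beta> \<in> \<Lambda>" "le \<alpha> \<beta>" for \<alpha> \<beta>
    using that unfolding \<Lambda>'_def T_def by blast
  have anti: "T \<beta> \<subseteq> T \<alpha>" if "\<alpha> \<in> \<Lambda>" "\<beta> \<in> \<Lambda>" "le \<alpha> \<beta>" for \<alpha> \<beta>
    unfolding T_def
  proof (intro image_mono subsetI CollectI)
    fix \<gamma> assume "\<gamma> \<in> {\<gamma> \<in> \<Lambda>. le \<beta> \<gamma>}"
    then have g: "\<gamma> \<in> \<Lambda>" "le \<beta> \<gamma>" by simp_all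
    show "\<gamma> \<in> \<Lambda> \<and> le \<alpha> \<gamma>" using g(1) tr[OF that(1,2) g(1) that(3) g(2)] by simp
  qed
  have "\<exists>r\<in>\<Lambda>'. le' p r \<and> le' q r" if pq: "p \<in> \<Lambda>'" "q \<in> \<Lambda>'" for p q
  proof -
    obtain \<alpha> \<beta> where ab: "\<alpha> \<in> \<Lambda>" "\<beta> \<in> \<Lambda>" "fst p = T \<alpha>" "fst q = T \<beta>"
      using pq by (auto simp: \<Lambda>'_def)
    obtain \<gamma> where "\<gamma> \<in> \<Lambda>" "le \<alpha> \<gamma>" "le \<beta> \<gamma>" using ub ab by blast
    moreover from this have "T \<gamma> \<subseteq> T \<alpha>" "T \<gamma> \<subseteq> T \<beta>" "(T \<gamma>, x \<gamma>) \<in> \<Lambda>'"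
      using ab(1,2) anti in' refl by simp_all
    ultimately show ?thesis
      using ab(3,4) by (intro bexI[of _ "(T \<gamma>, x \<gamma>)"]) (simp_all add: le'_def)
  qed
  moreover have "\<Lambda>' \<noteq> {}"
  proof -
    obtain \<alpha> where "\<alpha> \<in> \<Lambda>" using ne by blast
    from in'[OF this this refl[OF this]] show ?thesis by blast
  qed
  ultimately have dir': "directed_set \<Lambda>' le'"
    unfolding directed_set_def by (simp add: le'_def) blast
  have xY': "\<forall>p\<in>\<Lambda>'. snd p \<in> Y" using xY by (auto simp: \<Lambda>'_def T_def)
  obtain e where e: "e \<in> Y" "0 \<le> e" and zero: "0 \<in> Y" and
    C: "converges_rel (\<Lambda> \<times> \<Lambda>) (\<lambda>p q. le (fst p) (fst q) \<and> le (snd p) (snd q))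
          (\<lambda>p. x (fst p) - x (snd p)) 0 e"
    using Cau unfolding uniformly_Cauchy_in_def converges_uniformly_in_def by blast
  have "converges_rel (\<Lambda>' \<times> \<Lambda>') (\<lambda>p q. le' (fst p) (fst q) \<and> le' (snd p) (snd q))
          (\<lambda>p. snd (fst p) - snd (snd p)) 0 e"
    unfolding converges_rel_def
  proof (intro allI impI)
    fix \<epsilon> :: real assume "\<epsilon> > 0"
    then obtain p where p: "p \<in> \<Lambda> \<times> \<Lambda>" and pb: "\<forall>q\<in>\<Lambda> \<times> \<Lambda>. le (fst p) (fst q) \<and> le (snd p) (snd q)
         \<longrightarrow> \<bar>x (fst q) - x (snd q) - 0\<bar> \<le> \<epsilon> *\<^sub>R e"
      using C unfolding converges_rel_def by blast
    have pp: "fst p \<in> \<Lambda>" "snd p \<in> \<Lambda>" using p by auto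
    let ?p = "((T (fst p), x (fst p)), (T (snd p), x (snd p)))"
    have "\<bar>snd (fst q) - snd (snd q) - 0\<bar> \<le> \<epsilon> *\<^sub>R e"
      if q: "q \<in> \<Lambda>' \<times> \<Lambda>'" "le' (fst ?p) (fst q) \<and> le' (snd ?p) (snd q)" for q
    proof -
      have "snd (fst q) \<in> T (fst p)" "snd (snd q) \<in> T (snd p)"
        using q by (auto simp: \<Lambda>'_def le'_def)
      then obtain \<alpha> \<beta> where "\<alpha> \<in> \<Lambda>" "\<beta> \<in> \<Lambda>" "le (fst p) \<alpha>" "le (snd p) \<beta>"
        "snd (fst q) = x \<alpha>" "snd (snd q) = x \<beta>"
        by (auto simp: T_def)
      moreover from this have "\<bar>x (fst (\<alpha>, \<beta>)) - x (snd (\<alpha>, \<beta>)) - 0\<bar> \<le> \<epsilon> *\<^sub>R e"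
        by (intro pb[rule_format]) simp_all
      ultimately show ?thesis by simp
    qed
    moreover have "?p \<in> \<Lambda>' \<times> \<Lambda>'" using pp in' refl by simp
    ultimately show "\<exists>p\<in>\<Lambda>' \<times> \<Lambda>'. \<forall>q\<in>\<Lambda>' \<times> \<Lambda>'. le' (fst p) (fst q) \<and> le' (snd p) (snd q)
         \<longrightarrow> \<bar>snd (fst q) - snd (snd q) - 0\<bar> \<le> \<epsilon> *\<^sub>R e"
      by blast
  qed
  then have "uniformly_Cauchy_in Y \<Lambda>' le' snd"
    unfolding uniformly_Cauchy_in_def converges_uniformly_in_def using e zero by blast
  then obtain l where "converges_uniformly_in Y \<Lambda>' le' snd l"
    using Y dir' xY' unfolding uniformly_complete_def by blast
  then obtain d where l: "l \<in> Y" and d: "d \<in> Y" "0 \<le> d" and D: "converges_rel \<Lambda>' le' snd l d"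
    unfolding converges_uniformly_in_def by blast
  have "converges_rel \<Lambda> le x l d"
    unfolding converges_rel_def
  proof (intro allI impI)
    fix \<epsilon> :: real assume "\<epsilon> > 0"
    then obtain p where p: "p \<in> \<Lambda>'" and pb: "\<forall>q\<in>\<Lambda>'. le' p q \<longrightarrow> \<bar>snd q - l\<bar> \<le> \<epsilon> *\<^sub>R d"
      using D unfolding converges_rel_def by blast
    obtain \<alpha> where a: "\<alpha> \<in> \<Lambda>" "fst p = T \<alpha>" using p by (auto simp: \<Lambda>'_def)
    have "\<bar>x \<beta> - l\<bar> \<le> \<epsilon> *\<^sub>R d" if "\<beta> \<in> \<Lambda>" "le \<alpha> \<beta>" for \<beta>
      using pb[rule_format, OF in'[OF a(1) that]] a by (simp add: le'_def)
    then show "\<exists>\<alpha>\<^sub>0\<in>\<Lambda>. \<forall>\<alpha>\<in>\<Lambda>. le \<alpha>\<^sub>0 \<alpha> \<longrightarrow> \<bar>x \<alpha> - l\<bar> \<le> \<epsilon> *\<^sub>R d"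
      using a(1) by blast
  qed
  then show ?thesis using l d unfolding converges_uniformly_in_def by blast
qed


section \<open>Order completion and uniform completion\<close>

definition vector_lattice_hom_on ::
  "'a::archimedean_vector_lattice set \<Rightarrow> ('a \<Rightarrow> 'b::archimedean_vector_lattice) \<Rightarrow> bool" where
  "vector_lattice_hom_on A \<phi> \<longleftrightarrow>
     (\<forall>x\<in>A. \<forall>y\<in>A. \<phi> (x + y) = \<phi> x + \<phi> y) \<and> (\<forall>c. \<forall>x\<in>A. \<phi> (c *\<^sub>R x) = c *\<^sub>R \<phi> x) \<and>
     (\<forall>x\<in>A. \<forall>y\<in>A. \<phi> (sup x y) = sup (\<phi> x) (\<phi> y) \<and> \<phi> (inf x y) = inf (\<phi> x) (\<phi> y))"

definition vector_lattice_iso ::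
  "('a::archimedean_vector_lattice \<Rightarrow> 'b::archimedean_vector_lattice) \<Rightarrow> 'a set \<Rightarrow> 'b set \<Rightarrow> bool" where
  "vector_lattice_iso \<phi> A B \<longleftrightarrow> vector_lattice_hom_on A \<phi> \<and> bij_betw \<phi> A B"

text \<open>
  The order completion of \<open>X\<close> is determined up to isomorphism over \<open>X\<close>: a Dedekind complete vector
  lattice, here the whole type \<^typ>\<open>'d\<close>, together with a vector lattice embedding \<open>j\<close> of \<open>X\<close>
  whose image is majorizing and order dense.
\<close>

definition order_completion ::
  "'a::archimedean_vector_lattice set \<Rightarrow>
   ('a \<Rightarrow> 'd::{archimedean_vector_lattice, conditionally_complete_lattice}) \<Rightarrow> bool" where
  "order_completion X j \<longleftrightarrow> vector_lattice_hom_on X j \<and> inj_on j X \<and>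
     (\<forall>d. \<exists>x\<in>X. d \<le> j x) \<and> (\<forall>d>0. \<exists>x\<in>X. 0 < j x \<and> j x \<le> d)"

definition uniform_completion ::
  "'a::archimedean_vector_lattice set \<Rightarrow>
   ('a \<Rightarrow> 'd::{archimedean_vector_lattice, conditionally_complete_lattice}) \<Rightarrow> 'd set" where
  "uniform_completion X j = \<Inter> {Y. vector_sublattice Y \<and> j ` X \<subseteq> Y \<and> uniformly_complete Y}"


section \<open>The transfinite process\<close>

definition uniform_limits :: "'a::archimedean_vector_lattice set \<Rightarrow> 'a set" where
  "uniform_limits A = {z. \<exists>(x :: nat \<Rightarrow> 'a) e. (\<forall>n. x n \<in> A) \<and> e \<in> A \<and> 0 \<le> e \<and>
                            converges_rel UNIV (\<le>) x z e}"

text \<open>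
  As in the theory of cardinals of the library, an ordinal is a well-order relation \<open>r\<close>. The
  ordinals below \<open>r\<close> are its proper initial segments \<open>Restr r (underS r a)\<close> with
  \<open>a \<in> Field r\<close>. A nonempty \<open>r\<close> is a successor iff it has a greatest element \<open>m\<close>, and then the
  segment below \<open>m\<close> is its predecessor. (The value for relations that are not well-orders is
  irrelevant.)
\<close>

abbreviation is_greatest :: "'o rel \<Rightarrow> 'o \<Rightarrow> bool" where
  "is_greatest r m \<equiv> m \<in> Field r \<and> (\<forall>a\<in>Field r. (a, m) \<in> r)"

function stage :: "'a::archimedean_vector_lattice set \<Rightarrow> 'o rel \<Rightarrow> 'a set" where
  "stage X r =
     (if \<not> Well_order r \<or> Field r = {} then X
      else if \<exists>m. is_greatest r m
        then uniform_limits (stage X (Restr r (underS r (THE m. is_greatest r m))))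
      else (\<Union>a\<in>Field r. stage X (Restr r (underS r a))))"
  by auto
termination
  by (relation "inv_image ordLess snd")
     (auto intro: wf_inv_image wf_ordLess underS_Restr_ordLess)

declare stage.simps [simp del]

lemma stage_zero: "stage X {} = X"
  by (simp add: stage.simps)

lemma stage_succ:
  assumes "Well_order r" "is_greatest r m"
  shows "stage X r = uniform_limits (stage X (Restr r (underS r m)))"
proof -
  have "(THE m. is_greatest r m) = m"
    using assms by (intro the_equality)
      (auto simp: order_on_defs antisym_def)
  then show ?thesis using assms by (subst stage.simps) auto
qed

lemma stage_limit:
  assumes "Well_order r" "Field r \<noteq> {}" "\<nexists>m. is_greatest r m"
  shows "stage X r = (\<Union>a\<in>Field r. stage X (Restr r (underS r a)))"
  using assms by (subst stage.simps) auto

context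
  includes cardinal_syntax
begin

lemma stage_ordIso:
  fixes r :: "'o rel" and r' :: "'p rel"
  assumes "r =o r'"
  shows "stage X r = stage X r'"
  using assms
proof (induction r arbitrary: r' rule: wf_induct_rule[OF wf_ordLess])
  case (1 r)
  then have wo: "Well_order r" "Well_order r'" by (auto simp: ordIso_def)
  obtain f where f: "iso r r' f" using 1(2) by (auto simp: ordIso_def)
  then have bij: "bij_betw f (Field r) (Field r')" and emb: "embed r r' f"
    by (auto simp: iso_def)
  have img: "f ` Field r = Field r'" using bij by (simp add: bij_betw_def)
  have ord: "(f a, f b) \<in> r' \<longleftrightarrow> (a, b) \<in> r" if "a \<in> Field r" "b \<in> Field r" for a b
    using f that by (auto simp: iso_iff2)
  have fld: "Field (Restr s (underS s b)) = underS s b" if "Well_order s" for s :: "'o rel" and b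
    using that by (intro Field_Restr_ofilter wo_rel.underS_ofilter) (auto simp: wo_rel_def)
  have fld': "Field (Restr s (underS s b)) = underS s b" if "Well_order s" for s :: "'p rel" and b
    using that by (intro Field_Restr_ofilter wo_rel.underS_ofilter) (auto simp: wo_rel_def)
  have seg: "stage X (Restr r (underS r a)) = stage X (Restr r' (underS r' (f a)))"
    if a: "a \<in> Field r" for a
  proof (rule 1(1))
    show "(Restr r (underS r a), r) \<in> ordLess"
      using wo a by (intro underS_Restr_ordLess) auto
    have bS: "bij_betw f (underS r a) (underS r' (f a))"
      using embed_underS[OF wo(1) emb a] .
    have sub: "underS r a \<subseteq> Field r" by (auto simp: underS_def Field_def)
    have "iso (Restr r (underS r a)) (Restr r' (underS r' (f a))) f"
      unfolding iso_iff2 fld[OF wo(1)] fld'[OF wo(2)]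
      using bS ord sub bij_betwE[OF bS] by auto
    then show "Restr r (underS r a) =o Restr r' (underS r' (f a))"
      unfolding ordIso_def mem_Collect_eq case_prod_conv
      by (intro conjI exI[of _ f] Well_order_Restr wo)
  qed
  show ?case
  proof (cases "Field r = {}")
    case True
    then have "Field r' = {}" using img by auto
    with True show ?thesis by (simp add: stage.simps)
  next
    case ne: False
    then have ne': "Field r' \<noteq> {}" using img by auto
    show ?thesis
    proof (cases "\<exists>m. is_greatest r m")
      case True
      then obtain m where m: "is_greatest r m" by blast
      have m': "is_greatest r' (f m)" using ord m by (auto simp: img[symmetric])
      show ?thesis
        unfolding stage_succ[OF wo(1) m] stage_succ[OF wo(2) m']
        by (rule arg_cong[OF seg]) (use m in blast)
    next
      case False
      have no: "\<nexists>m. is_greatest r' m"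
      proof
        assume "\<exists>m. is_greatest r' m"
        then obtain m' where m': "is_greatest r' m'" by blast
        then have "m' \<in> f ` Field r" using img by simp
        then obtain m where m: "m \<in> Field r" "m' = f m" by (rule imageE)
        have "(a, m) \<in> r" if "a \<in> Field r" for a
        proof -
          have "f a \<in> Field r'" using that by (simp add: img[symmetric])
          then have "(f a, f m) \<in> r'" using m' m(2) by simp
          then show ?thesis using ord[OF that m(1)] by simp
        qed
        then have "is_greatest r m" using m(1) by simp
        with False show False by (simp only: not_ex)
      qed
      show ?thesis
        unfolding stage_limit[OF wo(1) ne False] stage_limit[OF wo(2) ne' no]
          img[symmetric] image_image
        by (rule SUP_cong[OF refl]) (rule seg)
    qed
  qed
qed

end

definition omega1 :: "nat set rel" where
  "omega1 = cardSuc natLeq"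

context
  includes cardinal_syntax
begin

lemma omega1_first_uncountable:
  "Well_order omega1" "\<not> countable (Field omega1)"
  "a \<in> Field omega1 \<Longrightarrow> countable (underS omega1 a)"
proof -
  have co: "Card_order omega1" unfolding omega1_def
    by (intro cardSuc_Card_order natLeq_Card_order)
  then show "Well_order omega1" by (rule card_order_on_well_order_on)
  have eq: "|Field omega1| =o omega1" using co by (rule card_of_Field_ordIso)
  have less: "natLeq <o omega1" unfolding omega1_def by (intro cardSuc_greater natLeq_Card_order)
  show "\<not> countable (Field omega1)"
  proof
    assume "countable (Field omega1)"
    then have "|Field omega1| \<le>o natLeq" by (simp only: countable_card_le_natLeq)
    then have "omega1 \<le>o natLeq" by (rule ordIso_ordLeq_trans[OF ordIso_symmetric[OF eq]])
    with less show False by (rule not_ordLess_ordLeq[THEN notE])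
  qed
  show "countable (underS omega1 a)" if "a \<in> Field omega1"
  proof -
    have "|underS omega1 a| <o cardSuc natLeq"
      using card_of_underS[OF co that] by (simp add: omega1_def)
    then show ?thesis unfolding countable_card_le_natLeq
      by (simp only: cardSuc_ordLeq_ordLess[OF natLeq_Card_order card_of_Card_order])
  qed
qed

end

end

theory Submission
  imports Defs
begin

text \<open>
  Every countable subset of \<open>X\<^sub>\<omega>\<^sub>1\<close> lies in some earlier stage, so \<open>X\<^sub>\<omega>\<^sub>1\<close> is the least set \<open>W\<close>
  containing \<open>X\<close> and closed under uniform limits of sequences; this gives the stabilization.
  By Zorn's lemma choose a maximal injective lattice homomorphism extending \<open>j\<close>, defined on a
  sublattice of \<open>Z\<close> and with values in \<open>X\<^sup>\<delta>\<close>. Such a homomorphism preserves and reflects uniform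
  convergence, and \<open>X\<^sup>\<delta>\<close> is uniformly complete, so it extends to uniform limits of sequences in its
  domain, and injectively so. By maximality its domain is closed under uniform limits and hence
  contains \<open>W\<close>. The image of \<open>W\<close> is uniformly complete because \<open>W\<close> is, and it is contained in every
  uniformly complete sublattice \<open>Y\<close> containing \<open>j X\<close> because the preimage of \<open>Y\<close> in \<open>W\<close> contains \<open>X\<close>
  and is closed under uniform limits.
\<close>

section \<open>Sequential uniform convergence\<close>

text \<open>The Archimedean axiom in epsilon form: take \<open>\<epsilon>\<close> to be
  \<open>1 / n\<close> and multiply by \<open>n\<close>. The case \<open>n = 0\<close> is where
  \<open>0 \<le> e\<close> enters. Uniqueness of limits and the change of regulators rest on
  this.\<close>

lemma le_zero_if_le_scaleR:
  fixes x e :: "'a::archimedean_vector_lattice"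
  assumes "0 \<le> e" and le: "\<And>\<epsilon>. \<epsilon> > 0 \<Longrightarrow> x \<le> \<epsilon> *\<^sub>R e"
  shows "x \<le> 0"
proof (rule archimedean)
  fix n :: nat
  show "real n *\<^sub>R x \<le> e"
  proof (cases "n = 0")
    case False
    then have "real n *\<^sub>R x \<le> real n *\<^sub>R ((1 / real n) *\<^sub>R e)"
      by (intro scaleR_left_mono le) auto
    then show ?thesis using False by simp
  qed (use assms in simp)
qed

section \<open>Order estimates for scalar multiples and the lattice operations\<close>

lemma abs_scaleR_le:
  fixes x :: "'a::archimedean_vector_lattice"
  shows "\<bar>c *\<^sub>R x\<bar> \<le> \<bar>c\<bar> *\<^sub>R \<bar>x\<bar>"
proof (cases "c \<ge> 0")
  case True
  have "c *\<^sub>R x \<le> c *\<^sub>R \<bar>x\<bar>" "c *\<^sub>R (- x) \<le> c *\<^sub>R \<bar>x\<bar>"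
    using True by (intro scaleR_left_mono abs_ge_self abs_ge_minus_self; simp)+
  then show ?thesis using True by (intro abs_leI) simp_all
next
  case False
  have "(- c) *\<^sub>R x \<le> (- c) *\<^sub>R \<bar>x\<bar>" "(- c) *\<^sub>R (- x) \<le> (- c) *\<^sub>R \<bar>x\<bar>"
    using False by (intro scaleR_left_mono abs_ge_self abs_ge_minus_self; simp)+
  then show ?thesis using False by (intro abs_leI) simp_all
qed

text \<open>Both \<open>x\<close> and \<open>y\<close> lie below \<open>sup z w\<close> plus the two
  error terms. Exchanging the two pairs gives the other half of the absolute value.\<close>

lemma abs_sup_diff_le:
  fixes x :: "'a::archimedean_vector_lattice"
  shows "\<bar>sup x y - sup z w\<bar> \<le> \<bar>x - z\<bar> + \<bar>y - w\<bar>"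
proof -
  have *: "sup x y \<le> sup z w + (\<bar>x - z\<bar> + \<bar>y - w\<bar>)" for x y z w :: 'a
  proof (rule sup_least)
    have "x = z + (x - z) + 0" by simp
    also have "\<dots> \<le> sup z w + \<bar>x - z\<bar> + \<bar>y - w\<bar>"
      by (intro add_mono abs_ge_self) auto
    finally show "x \<le> sup z w + (\<bar>x - z\<bar> + \<bar>y - w\<bar>)" by (simp add: add.assoc)
    have "y = w + 0 + (y - w)" by simp
    also have "\<dots> \<le> sup z w + \<bar>x - z\<bar> + \<bar>y - w\<bar>"
      by (intro add_mono abs_ge_self) auto
    finally show "y \<le> sup z w + (\<bar>x - z\<bar> + \<bar>y - w\<bar>)" by (simp add: add.assoc)
  qed
  show ?thesis
    using *[of x y z w] *[of z w x y]
    by (intro abs_leI) (simp_all only: abs_minus_commute[of z] abs_minus_commute[of w]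
      minus_diff_eq diff_le_eq add.commute)
qed

lemma abs_inf_diff_le:
  fixes x :: "'a::archimedean_vector_lattice"
  shows "\<bar>inf x y - inf z w\<bar> \<le> \<bar>x - z\<bar> + \<bar>y - w\<bar>"
proof -
  have eq: "- a - - b = b - a" for a b :: 'a by simp
  have "\<bar>sup (- z) (- w) - sup (- x) (- y)\<bar> \<le> \<bar>- z - - x\<bar> + \<bar>- w - - y\<bar>"
    by (rule abs_sup_diff_le)
  then show ?thesis by (simp only: eq flip: neg_inf_eq_sup)
qed

section \<open>Limits and Cauchy sequences relative to a regulator\<close>

abbreviation seq_conv :: "(nat \<Rightarrow> 'a::archimedean_vector_lattice) \<Rightarrow> 'a \<Rightarrow> 'a \<Rightarrow> bool" where
  "seq_conv \<equiv> converges_rel UNIV (\<le>)"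

definition seq_Cauchy :: "(nat \<Rightarrow> 'a::archimedean_vector_lattice) \<Rightarrow> 'a \<Rightarrow> bool" where
  "seq_Cauchy x e \<longleftrightarrow> (\<forall>\<epsilon>>0. \<exists>N. \<forall>m\<ge>N. \<forall>n\<ge>N. \<bar>x m - x n\<bar> \<le> \<epsilon> *\<^sub>R e)"

text \<open>The limit is taken relative to the given regulator \<open>e\<close> itself. By
  \<open>seq_conv_change_regulator\<close> a limit relative to any other positive regulator yields
  this one, so no second regulator has to be tracked.\<close>

definition seq_complete :: "'a::archimedean_vector_lattice set \<Rightarrow> bool" where
  "seq_complete Y \<longleftrightarrow> (\<forall>x e. (\<forall>n. x n \<in> Y) \<longrightarrow> e \<in> Y \<longrightarrow> 0 \<le> e \<longrightarrow> seq_Cauchy x e \<longrightarrow>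
     (\<exists>l\<in>Y. seq_conv x l e))"

lemma seq_completeD:
  assumes "seq_complete Y" "\<And>n. x n \<in> Y" "e \<in> Y" "0 \<le> e" "seq_Cauchy x e"
  shows "\<exists>l\<in>Y. seq_conv x l e"
  using assms unfolding seq_complete_def by simp

text \<open>The estimate shared by addition, scalar multiples, \<open>sup\<close> and
  \<open>inf\<close>. Compatibility with limits is proved once for a generic operation of this
  kind.\<close>

definition lipschitz_op ::
  "real \<Rightarrow> ('a::archimedean_vector_lattice \<Rightarrow> 'a \<Rightarrow> 'a) \<Rightarrow> bool" where
  "lipschitz_op K f \<longleftrightarrow> (\<forall>x y z w. \<bar>f x y - f z w\<bar> \<le> K *\<^sub>R (\<bar>x - z\<bar> + \<bar>y - w\<bar>))"

lemma lipschitz_op_lattice: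
  "lipschitz_op 1 (sup :: 'a::archimedean_vector_lattice \<Rightarrow> _)"
  "lipschitz_op 1 (inf :: 'a::archimedean_vector_lattice \<Rightarrow> _)"
  unfolding lipschitz_op_def scaleR_one by (intro allI abs_sup_diff_le abs_inf_diff_le)+

lemma lipschitz_op_add: "lipschitz_op 1 (\<lambda>x y::'a::archimedean_vector_lattice. x + y)"
proof -
  have "\<bar>x + y - (z + w)\<bar> \<le> \<bar>x - z\<bar> + \<bar>y - w\<bar>" for x y z w :: 'a
    using abs_triangle_ineq[of "x - z" "y - w"] by (simp add: algebra_simps)
  then show ?thesis by (simp add: lipschitz_op_def)
qed

text \<open>The dummy second argument lets scalar multiples be treated like the binary operations.\<close>

lemma lipschitz_op_scaleR:
  "lipschitz_op \<bar>c\<bar> (\<lambda>x y::'a::archimedean_vector_lattice. c *\<^sub>R x)"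
proof -
  have "\<bar>c *\<^sub>R x - c *\<^sub>R z\<bar> \<le> \<bar>c\<bar> *\<^sub>R (\<bar>x - z\<bar> + \<bar>y - w\<bar>)" for x y z w :: 'a
  proof -
    have "\<bar>c *\<^sub>R x - c *\<^sub>R z\<bar> \<le> \<bar>c\<bar> *\<^sub>R \<bar>x - z\<bar>"
      using abs_scaleR_le[of c "x - z"] by (simp add: scaleR_diff_right)
    also have "\<dots> \<le> \<bar>c\<bar> *\<^sub>R (\<bar>x - z\<bar> + \<bar>y - w\<bar>)"
      by (intro scaleR_left_mono) simp_all
    finally show ?thesis .
  qed
  then show ?thesis by (simp add: lipschitz_op_def)
qed

lemma seq_convD:
  assumes "seq_conv x l e" "\<epsilon> > 0"
  obtains N where "\<And>n. n \<ge> N \<Longrightarrow> \<bar>x n - l\<bar> \<le> \<epsilon> *\<^sub>R e"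
  using assms unfolding converges_rel_def by auto

lemma seq_convI:
  assumes "\<And>\<epsilon>. \<epsilon> > 0 \<Longrightarrow> \<exists>N. \<forall>n\<ge>N. \<bar>x n - l\<bar> \<le> \<epsilon> *\<^sub>R e"
  shows "seq_conv x l e"
  using assms unfolding converges_rel_def by auto

lemma seq_conv_const: "seq_conv (\<lambda>_. x) x 0"
  by (rule seq_convI) simp

lemma seq_conv_mono:
  assumes "seq_conv x l e" "e \<le> e'"
  shows "seq_conv x l e'"
proof (rule seq_convI)
  fix \<epsilon> :: real assume "\<epsilon> > 0"
  obtain N where "\<And>n. n \<ge> N \<Longrightarrow> \<bar>x n - l\<bar> \<le> \<epsilon> *\<^sub>R e"
    using seq_convD[OF assms(1) \<open>\<epsilon> > 0\<close>] by blast
  then show "\<exists>N. \<forall>n\<ge>N. \<bar>x n - l\<bar> \<le> \<epsilon> *\<^sub>R e'"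
    using scaleR_left_mono[OF assms(2), of \<epsilon>] \<open>\<epsilon> > 0\<close> by (meson less_imp_le order_trans)
qed

lemma seq_conv_op:
  assumes "seq_conv x z e" "seq_conv y w d" "lipschitz_op K f" "K \<ge> 0" "0 \<le> e" "0 \<le> d"
  shows "seq_conv (\<lambda>n. f (x n) (y n)) (f z w) (e + d)"
proof (rule seq_convI)
  fix \<epsilon> :: real assume e: "\<epsilon> > 0"
  \<comment> \<open>Dividing by \<open>K + 1\<close> covers \<open>K = 0\<close>, which occurs for
    multiplication by the scalar 0.\<close>
  define \<delta> where "\<delta> = \<epsilon> / (K + 1)"
  have \<delta>: "\<delta> > 0" "K * \<delta> \<le> \<epsilon>" using e assms(4) by (auto simp: \<delta>_def field_simps)
  obtain N where N: "\<And>n. n \<ge> N \<Longrightarrow> \<bar>x n - z\<bar> \<le> \<delta> *\<^sub>R e"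
    using seq_convD[OF assms(1) \<delta>(1)] by blast
  obtain M where M: "\<And>n. n \<ge> M \<Longrightarrow> \<bar>y n - w\<bar> \<le> \<delta> *\<^sub>R d"
    using seq_convD[OF assms(2) \<delta>(1)] by blast
  have "\<bar>f (x n) (y n) - f z w\<bar> \<le> \<epsilon> *\<^sub>R (e + d)" if n: "n \<ge> max N M" for n
  proof -
    have "\<bar>f (x n) (y n) - f z w\<bar> \<le> K *\<^sub>R (\<bar>x n - z\<bar> + \<bar>y n - w\<bar>)"
      using assms(3) by (simp add: lipschitz_op_def)
    also have "\<dots> \<le> K *\<^sub>R (\<delta> *\<^sub>R e + \<delta> *\<^sub>R d)"
      using n assms(4) by (intro scaleR_left_mono add_mono N M) auto
    also have "\<dots> = (K * \<delta>) *\<^sub>R (e + d)" by (simp add: scaleR_add_right)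
    also have "\<dots> \<le> \<epsilon> *\<^sub>R (e + d)"
      using assms(5,6) by (intro scaleR_right_mono \<delta>(2)) simp
    finally show ?thesis .
  qed
  then show "\<exists>N. \<forall>n\<ge>N. \<bar>f (x n) (y n) - f z w\<bar> \<le> \<epsilon> *\<^sub>R (e + d)" by blast
qed

lemma abs_diff_le_add:
  fixes a b c :: "'a::archimedean_vector_lattice"
  assumes "\<bar>a - b\<bar> \<le> u" "\<bar>c - b\<bar> \<le> v"
  shows "\<bar>a - c\<bar> \<le> u + v"
proof -
  have "\<bar>a - c\<bar> \<le> \<bar>a - b\<bar> + \<bar>b - c\<bar>"
    using abs_triangle_ineq[of "a - b" "b - c"] by simp
  also have "\<dots> \<le> u + v"
    using assms by (intro add_mono) (simp_all add: abs_minus_commute)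
  finally show ?thesis .
qed

lemma half_scaleR_add: "(\<epsilon> / 2) *\<^sub>R e + (\<epsilon> / 2) *\<^sub>R e = \<epsilon> *\<^sub>R (e::'a::real_vector)"
  by (simp flip: scaleR_add_left)

lemma seq_conv_unique:
  assumes "seq_conv x l e" "seq_conv x m d" "0 \<le> e" "0 \<le> d"
  shows "l = m"
proof -
  \<comment> \<open>The sum \<open>e + d\<close> is a common regulator for both limits.\<close>
  have 1: "seq_conv x l (e + d)" "seq_conv x m (e + d)"
    using assms by (auto intro: seq_conv_mono)
  have "\<bar>l - m\<bar> \<le> \<epsilon> *\<^sub>R (e + d)" if "\<epsilon> > 0" for \<epsilon>
  proof -
    have h: "\<epsilon> / 2 > 0" using that by simp
    obtain N where N: "\<And>n. n \<ge> N \<Longrightarrow> \<bar>x n - l\<bar> \<le> (\<epsilon> / 2) *\<^sub>R (e + d)"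
      using seq_convD[OF 1(1) h] by blast
    obtain M where M: "\<And>n. n \<ge> M \<Longrightarrow> \<bar>x n - m\<bar> \<le> (\<epsilon> / 2) *\<^sub>R (e + d)"
      using seq_convD[OF 1(2) h] by blast
    have "\<bar>l - m\<bar> \<le> (\<epsilon> / 2) *\<^sub>R (e + d) + (\<epsilon> / 2) *\<^sub>R (e + d)"
      using N[of "max N M"] M[of "max N M"]
      by (intro abs_diff_le_add[where b = "x (max N M)"]) (simp_all add: abs_minus_commute)
    then show ?thesis by (simp only: half_scaleR_add)
  qed
  then have "\<bar>l - m\<bar> \<le> 0" using assms(3,4) by (intro le_zero_if_le_scaleR[of "e + d"]) auto
  then show ?thesis by simp
qed

lemma seq_conv_imp_Cauchy:
  assumes "seq_conv x l e"
  shows "seq_Cauchy x e"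
  unfolding seq_Cauchy_def
proof (intro allI impI)
  fix \<epsilon> :: real assume "\<epsilon> > 0"
  then have h: "\<epsilon> / 2 > 0" by simp
  obtain N where N: "\<And>n. n \<ge> N \<Longrightarrow> \<bar>x n - l\<bar> \<le> (\<epsilon> / 2) *\<^sub>R e"
    using seq_convD[OF assms h] by blast
  have "\<bar>x m - x n\<bar> \<le> \<epsilon> *\<^sub>R e" if "m \<ge> N" "n \<ge> N" for m n
    using abs_diff_le_add[OF N N, OF that] by (simp only: half_scaleR_add)
  then show "\<exists>N. \<forall>m\<ge>N. \<forall>n\<ge>N. \<bar>x m - x n\<bar> \<le> \<epsilon> *\<^sub>R e" by blast
qed

text \<open>Let one index of the Cauchy estimate run to infinity. Replacing the far term by
  \<open>l\<close> costs \<open>\<delta> *\<^sub>R d\<close> for arbitrary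
  \<open>\<delta> > 0\<close>, and the Archimedean property removes this error.\<close>

lemma seq_conv_change_regulator:
  assumes C: "seq_Cauchy x e" and l: "seq_conv x l d" and "0 \<le> d"
  shows "seq_conv x l e"
proof (rule seq_convI)
  fix \<epsilon> :: real assume "\<epsilon> > 0"
  then obtain N where N: "\<And>m n. m \<ge> N \<Longrightarrow> n \<ge> N \<Longrightarrow> \<bar>x m - x n\<bar> \<le> \<epsilon> *\<^sub>R e"
    using C unfolding seq_Cauchy_def by blast
  have "\<bar>x n - l\<bar> \<le> \<epsilon> *\<^sub>R e" if n: "n \<ge> N" for n
  proof -
    have "\<bar>x n - l\<bar> - \<epsilon> *\<^sub>R e \<le> \<delta> *\<^sub>R d" if "\<delta> > 0" for \<delta>
    proof -
      obtain M where M: "\<And>n. n \<ge> M \<Longrightarrow> \<bar>x n - l\<bar> \<le> \<delta> *\<^sub>R d"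
        using seq_convD[OF l \<open>\<delta> > 0\<close>] by blast
      have "\<bar>x n - l\<bar> \<le> \<epsilon> *\<^sub>R e + \<delta> *\<^sub>R d"
        using N[OF n, of "max N M"] M[of "max N M"]
        by (intro abs_diff_le_add[where b = "x (max N M)"]) (simp_all add: abs_minus_commute)
      then show ?thesis by (simp add: algebra_simps)
    qed
    then have "\<bar>x n - l\<bar> - \<epsilon> *\<^sub>R e \<le> 0" by (rule le_zero_if_le_scaleR[OF \<open>0 \<le> d\<close>])
    then show ?thesis by simp
  qed
  then show "\<exists>N. \<forall>n\<ge>N. \<bar>x n - l\<bar> \<le> \<epsilon> *\<^sub>R e" by blast
qed

section \<open>Completeness for nets and for sequences\<close>

lemma seq_complete_if_uniformly_complete:
  assumes Y: "uniformly_complete Y" and sub: "vector_sublattice Y"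
  shows "seq_complete Y"
  unfolding seq_complete_def
proof (intro allI impI)
  fix x :: "nat \<Rightarrow> 'a" and e
  assume x: "\<forall>n. x n \<in> Y" and e: "e \<in> Y" "0 \<le> e" and C: "seq_Cauchy x e"
  have zero: "0 \<in> Y" using sub by (auto simp: vector_sublattice_def subspace_def)
  have dir: "directed_set (UNIV :: nat set) (\<le>)"
    unfolding directed_set_def by (auto intro: max.cobounded1 max.cobounded2)
  have "converges_rel (UNIV \<times> UNIV) (\<lambda>p q. fst p \<le> fst q \<and> snd p \<le> snd q)
          (\<lambda>p. x (fst p) - x (snd p)) 0 e"
    unfolding converges_rel_def
  proof (intro allI impI)
    fix \<epsilon> :: real assume "\<epsilon> > 0"
    then obtain N where "\<forall>m\<ge>N. \<forall>n\<ge>N. \<bar>x m - x n\<bar> \<le> \<epsilon> *\<^sub>R e"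
      using C unfolding seq_Cauchy_def by blast
    then show "\<exists>p\<in>UNIV \<times> UNIV. \<forall>q\<in>UNIV \<times> UNIV. fst p \<le> fst q \<and> snd p \<le> snd q \<longrightarrow>
        \<bar>x (fst q) - x (snd q) - 0\<bar> \<le> \<epsilon> *\<^sub>R e"
      by (intro bexI[of _ "(N, N)"]) auto
  qed
  then have "uniformly_Cauchy_in Y UNIV (\<le>) x"
    unfolding uniformly_Cauchy_in_def converges_uniformly_in_def using e zero by blast
  then obtain l where "converges_uniformly_in Y UNIV (\<le>) x l"
    using uniformly_completeD[OF Y dir] x by blast
  \<comment> \<open>Net completeness provides some regulator in \<open>Y\<close>; the Cauchy
    property relative to \<open>e\<close> brings back \<open>e\<close>.\<close>
  then show "\<exists>l\<in>Y. seq_conv x l e"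
    unfolding converges_uniformly_in_def using seq_conv_change_regulator[OF C] by blast
qed

lemma ex_inverse_Suc_le:
  fixes \<epsilon> :: real assumes "\<epsilon> > 0"
  obtains k where "\<And>n. n \<ge> k \<Longrightarrow> 1 / real (Suc n) \<le> \<epsilon>"
proof -
  obtain k where k: "inverse (real (Suc k)) < \<epsilon>" using reals_Archimedean[OF assms] by blast
  have "1 / real (Suc n) \<le> \<epsilon>" if "n \<ge> k" for n
  proof -
    have "1 / real (Suc n) \<le> 1 / real (Suc k)" using that by (intro divide_left_mono) auto
    then show ?thesis using k by (simp add: inverse_eq_divide)
  qed
  then show ?thesis by (rule that)
qed

text \<open>A regulator controls the net by countably many bounds. Indices \<open>\<gamma> n\<close>
  beyond which the net stays within \<open>e / (n + 1)\<close> of its value at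
  \<open>\<gamma> n\<close> give a Cauchy sequence, whose limit is also the limit of the
  net.\<close>

lemma uniformly_complete_if_seq_complete:
  fixes Y :: "'a::archimedean_vector_lattice set"
  assumes Y: "seq_complete Y"
  shows "uniformly_complete Y"
  unfolding uniformly_complete_def
proof (intro allI impI)
  fix \<Lambda> :: "('a set \<times> 'a) set" and le x
  assume dir: "directed_set \<Lambda> le" and xY: "\<forall>\<alpha>\<in>\<Lambda>. x \<alpha> \<in> Y"
    and C: "uniformly_Cauchy_in Y \<Lambda> le x"
  obtain e where e: "e \<in> Y" "0 \<le> e" and C:
    "converges_rel (\<Lambda> \<times> \<Lambda>) (\<lambda>p q. le (fst p) (fst q) \<and> le (snd p) (snd q))
       (\<lambda>p. x (fst p) - x (snd p)) 0 e"
    using C unfolding uniformly_Cauchy_in_def converges_uniformly_in_def by blast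
  have refl: "\<And>\<alpha>. \<alpha> \<in> \<Lambda> \<Longrightarrow> le \<alpha> \<alpha>"
    and tr: "\<And>\<alpha> \<beta> \<gamma>. \<lbrakk>\<alpha> \<in> \<Lambda>; \<beta> \<in> \<Lambda>; \<gamma> \<in> \<Lambda>; le \<alpha> \<beta>; le \<beta> \<gamma>\<rbrakk> \<Longrightarrow> le \<alpha> \<gamma>"
    and ub: "\<And>\<alpha> \<beta>. \<lbrakk>\<alpha> \<in> \<Lambda>; \<beta> \<in> \<Lambda>\<rbrakk> \<Longrightarrow> \<exists>\<gamma>\<in>\<Lambda>. le \<alpha> \<gamma> \<and> le \<beta> \<gamma>"
    using dir unfolding directed_set_def by blast+
  have "\<exists>\<gamma>\<in>\<Lambda>. \<forall>\<alpha>\<in>\<Lambda>. le \<gamma> \<alpha> \<longrightarrow> \<bar>x \<alpha> - x \<gamma>\<bar> \<le> (1 / real (Suc n)) *\<^sub>R e" for n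
  proof -
    obtain p where p: "p \<in> \<Lambda> \<times> \<Lambda>" and pb: "\<And>q. q \<in> \<Lambda> \<times> \<Lambda> \<Longrightarrow>
      le (fst p) (fst q) \<and> le (snd p) (snd q) \<Longrightarrow>
      \<bar>x (fst q) - x (snd q) - 0\<bar> \<le> (1 / real (Suc n)) *\<^sub>R e"
      using C[unfolded converges_rel_def, rule_format, of "1 / real (Suc n)"] by auto
    have pp: "fst p \<in> \<Lambda>" "snd p \<in> \<Lambda>" using p by auto
    then obtain \<gamma> where g: "\<gamma> \<in> \<Lambda>" "le (fst p) \<gamma>" "le (snd p) \<gamma>" using ub by blast
    have "\<bar>x \<alpha> - x \<gamma>\<bar> \<le> (1 / real (Suc n)) *\<^sub>R e" if "\<alpha> \<in> \<Lambda>" "le \<gamma> \<alpha>" for \<alpha>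
      using pb[of "(\<alpha>, \<gamma>)"] that g tr[OF pp(1) g(1) that(1) g(2) that(2)] by simp
    with g(1) show ?thesis by blast
  qed
  then obtain \<gamma> where g: "\<And>n. \<gamma> n \<in> \<Lambda>"
    and gb: "\<And>n \<alpha>. \<alpha> \<in> \<Lambda> \<Longrightarrow> le (\<gamma> n) \<alpha> \<Longrightarrow> \<bar>x \<alpha> - x (\<gamma> n)\<bar> \<le> (1 / real (Suc n)) *\<^sub>R e"
    by metis
  have small: "\<exists>k. \<forall>n\<ge>k. \<forall>\<alpha>\<in>\<Lambda>. le (\<gamma> n) \<alpha> \<longrightarrow> \<bar>x \<alpha> - x (\<gamma> n)\<bar> \<le> \<epsilon> *\<^sub>R e" if "\<epsilon> > 0" for \<epsilon>
  proof -
    obtain k where k: "\<And>n. n \<ge> k \<Longrightarrow> 1 / real (Suc n) \<le> \<epsilon>"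
      using ex_inverse_Suc_le[OF \<open>\<epsilon> > 0\<close>] by metis
    have "(1 / real (Suc n)) *\<^sub>R e \<le> \<epsilon> *\<^sub>R e" if "n \<ge> k" for n
      using k[OF that] e(2) by (intro scaleR_right_mono)
    then show ?thesis using gb by (meson order_trans)
  qed
  have "seq_Cauchy (\<lambda>n. x (\<gamma> n)) e"
    unfolding seq_Cauchy_def
  proof (intro allI impI)
    fix \<epsilon> :: real assume "\<epsilon> > 0"
    then have h: "\<epsilon> / 2 > 0" by simp
    obtain k where k: "\<And>n \<alpha>. n \<ge> k \<Longrightarrow> \<alpha> \<in> \<Lambda> \<Longrightarrow> le (\<gamma> n) \<alpha> \<Longrightarrow>
        \<bar>x \<alpha> - x (\<gamma> n)\<bar> \<le> (\<epsilon> / 2) *\<^sub>R e"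
      using small[OF h] by blast
    have "\<bar>x (\<gamma> m) - x (\<gamma> n)\<bar> \<le> \<epsilon> *\<^sub>R e" if mn: "m \<ge> k" "n \<ge> k" for m n
    proof -
      \<comment> \<open>The indices \<open>\<gamma> n\<close> are not chosen increasing, so two of
        them are compared through a common upper bound.\<close>
      obtain \<delta> where d: "\<delta> \<in> \<Lambda>" "le (\<gamma> m) \<delta>" "le (\<gamma> n) \<delta>" using ub g by blast
      have "\<bar>x (\<gamma> m) - x (\<gamma> n)\<bar> \<le> (\<epsilon> / 2) *\<^sub>R e + (\<epsilon> / 2) *\<^sub>R e"
        using k[OF mn(1) d(1,2)] k[OF mn(2) d(1,3)]
        by (intro abs_diff_le_add[where b = "x \<delta>"]) (simp_all add: abs_minus_commute)
      then show ?thesis by (simp only: half_scaleR_add)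
    qed
    then show "\<exists>N. \<forall>m\<ge>N. \<forall>n\<ge>N. \<bar>x (\<gamma> m) - x (\<gamma> n)\<bar> \<le> \<epsilon> *\<^sub>R e" by blast
  qed
  with Y e have "\<exists>l\<in>Y. seq_conv (\<lambda>n. x (\<gamma> n)) l e"
    using xY g by (intro seq_completeD) auto
  then obtain l where l: "l \<in> Y" "seq_conv (\<lambda>n. x (\<gamma> n)) l e" by blast
  have "converges_rel \<Lambda> le x l e"
    unfolding converges_rel_def
  proof (intro allI impI)
    fix \<epsilon> :: real assume "\<epsilon> > 0"
    then have h: "\<epsilon> / 2 > 0" by simp
    obtain k where k: "\<And>n \<alpha>. n \<ge> k \<Longrightarrow> \<alpha> \<in> \<Lambda> \<Longrightarrow> le (\<gamma> n) \<alpha> \<Longrightarrow>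
        \<bar>x \<alpha> - x (\<gamma> n)\<bar> \<le> (\<epsilon> / 2) *\<^sub>R e"
      using small[OF h] by blast
    obtain N where N: "\<And>n. n \<ge> N \<Longrightarrow> \<bar>x (\<gamma> n) - l\<bar> \<le> (\<epsilon> / 2) *\<^sub>R e"
      using seq_convD[OF l(2) h] by blast
    \<comment> \<open>Past \<open>k\<close> the net varies little beyond \<open>\<gamma> n\<close>;
      past \<open>N\<close> the value at \<open>\<gamma> n\<close> is close to \<open>l\<close>. The
      index \<open>max k N\<close> achieves both.\<close>
    have "\<bar>x \<alpha> - l\<bar> \<le> \<epsilon> *\<^sub>R e" if "\<alpha> \<in> \<Lambda>" "le (\<gamma> (max k N)) \<alpha>" for \<alpha>
    proof -
      have "\<bar>x \<alpha> - l\<bar> \<le> (\<epsilon> / 2) *\<^sub>R e + (\<epsilon> / 2) *\<^sub>R e"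
        using k[OF _ that] N[of "max k N"]
        by (intro abs_diff_le_add[where b = "x (\<gamma> (max k N))"]) (simp_all add: abs_minus_commute)
      then show ?thesis by (simp only: half_scaleR_add)
    qed
    then show "\<exists>\<alpha>\<^sub>0\<in>\<Lambda>. \<forall>\<alpha>\<in>\<Lambda>. le \<alpha>\<^sub>0 \<alpha> \<longrightarrow> \<bar>x \<alpha> - l\<bar> \<le> \<epsilon> *\<^sub>R e" using g by blast
  qed
  then show "\<exists>l. converges_uniformly_in Y \<Lambda> le x l"
    unfolding converges_uniformly_in_def using l(1) e by blast
qed

text \<open>A nested interval argument: the order interval from \<open>lo k\<close> to
  \<open>hi k\<close> contains a tail of the sequence, so every \<open>lo k\<close> lies below every
  \<open>hi l\<close>. The supremum of the lower ends then lies in all these intervals, whose widths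
  are multiples of \<open>e\<close> tending to 0.\<close>

lemma seq_complete_Dedekind_complete:
  "seq_complete (UNIV :: 'd::{archimedean_vector_lattice, conditionally_complete_lattice} set)"
  unfolding seq_complete_def
proof (intro allI impI)
  fix x :: "nat \<Rightarrow> 'd" and e
  assume e: "0 \<le> e" and C: "seq_Cauchy x e"
  have "\<exists>N. \<forall>m\<ge>N. \<forall>n\<ge>N. \<bar>x m - x n\<bar> \<le> (1 / real (Suc k)) *\<^sub>R e" for k
    using C[unfolded seq_Cauchy_def, rule_format, of "1 / real (Suc k)"] by simp
  then obtain N where N: "\<And>k m n. m \<ge> N k \<Longrightarrow> n \<ge> N k \<Longrightarrow>
      \<bar>x m - x n\<bar> \<le> (1 / real (Suc k)) *\<^sub>R e"
    by metis
  define lo hi where "lo k = x (N k) - (1 / real (Suc k)) *\<^sub>R e"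
    and "hi k = x (N k) + (1 / real (Suc k)) *\<^sub>R e" for k
  have lohi: "lo k \<le> x n" "x n \<le> hi k" if "n \<ge> N k" for k n
    using abs_le_D1[OF N[of k "N k" n]] abs_le_D1[OF N[of k n "N k"]] that
    by (simp_all add: lo_def hi_def algebra_simps)
  have cross: "lo k \<le> hi l" for k l
    using lohi(1)[of k "max (N k) (N l)"] lohi(2)[of l "max (N k) (N l)"] by simp
  define d where "d = Sup (range lo)"
  have "bdd_above (range lo)" using cross by (intro bdd_aboveI[of _ "hi 0"]) auto
  then have lod: "lo k \<le> d" for k unfolding d_def by (intro cSup_upper) auto
  have dhi: "d \<le> hi k" for k unfolding d_def using cross by (intro cSup_least) auto
  have "seq_conv x d e"
  proof (rule seq_convI)
    fix \<epsilon> :: real assume "\<epsilon> > 0"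
    then have h: "\<epsilon> / 2 > 0" by simp
    obtain k where k: "\<And>n. n \<ge> k \<Longrightarrow> 1 / real (Suc n) \<le> \<epsilon> / 2"
      using ex_inverse_Suc_le[OF h] by metis
    have ke: "(1 / real (Suc k)) *\<^sub>R e \<le> (\<epsilon> / 2) *\<^sub>R e"
      using k e by (intro scaleR_right_mono) auto
    have "\<bar>x n - d\<bar> \<le> \<epsilon> *\<^sub>R e" if n: "n \<ge> N k" for n
    proof -
      have "\<bar>x n - x (N k)\<bar> \<le> (\<epsilon> / 2) *\<^sub>R e" using N[OF n order_refl] ke by (rule order_trans)
      moreover have "\<bar>d - x (N k)\<bar> \<le> (1 / real (Suc k)) *\<^sub>R e"
        using lod[of k] dhi[of k] by (intro abs_leI) (simp_all add: lo_def hi_def algebra_simps)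
      then have "\<bar>d - x (N k)\<bar> \<le> (\<epsilon> / 2) *\<^sub>R e" using ke by (rule order_trans)
      ultimately have "\<bar>x n - d\<bar> \<le> (\<epsilon> / 2) *\<^sub>R e + (\<epsilon> / 2) *\<^sub>R e" by (rule abs_diff_le_add)
      then show ?thesis by (simp only: half_scaleR_add)
    qed
    then show "\<exists>N. \<forall>n\<ge>N. \<bar>x n - d\<bar> \<le> \<epsilon> *\<^sub>R e" by blast
  qed
  then show "\<exists>l\<in>UNIV. seq_conv x l e" by blast
qed


section \<open>The stages\<close>

lemma uniform_limits_mono: "A \<subseteq> B \<Longrightarrow> uniform_limits A \<subseteq> uniform_limits B"
  unfolding uniform_limits_def by blast

lemma uniform_limits_superset: "0 \<in> A \<Longrightarrow> A \<subseteq> uniform_limits A"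
  unfolding uniform_limits_def
proof (intro subsetI CollectI)
  fix z assume "0 \<in> A" "z \<in> A"
  then show "\<exists>x e. (\<forall>n. x n \<in> A) \<and> e \<in> A \<and> 0 \<le> e \<and> seq_conv x z e"
    using seq_conv_const by (intro exI[of _ "\<lambda>_. z"] exI[of _ 0]) auto
qed

text \<open>Closure under addition keeps the regulator \<open>e + d\<close> of the combined sequence
  inside \<open>A\<close>.\<close>

lemma uniform_limits_op:
  assumes "\<And>a b. a \<in> A \<Longrightarrow> b \<in> A \<Longrightarrow> f a b \<in> A" "\<And>a b. a \<in> A \<Longrightarrow> b \<in> A \<Longrightarrow> a + b \<in> A"
    and "lipschitz_op K f" "K \<ge> 0" and u: "u \<in> uniform_limits A" and v: "v \<in> uniform_limits A"
  shows "f u v \<in> uniform_limits A"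
proof -
  obtain x e where x: "\<And>n. x n \<in> A" "e \<in> A" "0 \<le> e" "seq_conv x u e"
    using u unfolding uniform_limits_def by blast
  obtain y d where y: "\<And>n. y n \<in> A" "d \<in> A" "0 \<le> d" "seq_conv y v d"
    using v unfolding uniform_limits_def by blast
  have "seq_conv (\<lambda>n. f (x n) (y n)) (f u v) (e + d)"
    using x y assms by (intro seq_conv_op)
  then show ?thesis unfolding uniform_limits_def
    using x y assms(1,2) by (intro CollectI exI conjI) auto
qed

lemma vector_sublattice_uniform_limits:
  assumes A: "vector_sublattice A"
  shows "vector_sublattice (uniform_limits A)"
proof -
  have ops: "0 \<in> A" "\<And>a b. a \<in> A \<Longrightarrow> b \<in> A \<Longrightarrow> a + b \<in> A" "\<And>c a. a \<in> A \<Longrightarrow> c *\<^sub>R a \<in> A"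
    "\<And>a b. a \<in> A \<Longrightarrow> b \<in> A \<Longrightarrow> sup a b \<in> A" "\<And>a b. a \<in> A \<Longrightarrow> b \<in> A \<Longrightarrow> inf a b \<in> A"
    using A by (auto simp: vector_sublattice_def subspace_def)
  have op: "f u v \<in> uniform_limits A"
    if "\<And>a b. a \<in> A \<Longrightarrow> b \<in> A \<Longrightarrow> f a b \<in> A" "lipschitz_op K f" "K \<ge> 0"
      "u \<in> uniform_limits A" "v \<in> uniform_limits A" for f K u v
    using that ops(2) by (intro uniform_limits_op[of A f K])
  show ?thesis
    unfolding vector_sublattice_def subspace_def
  proof (intro conjI ballI allI)
    show "0 \<in> uniform_limits A" using uniform_limits_superset[OF ops(1)] ops(1) by blast
  next
    fix k x assume "x \<in> uniform_limits A"
    then show "k *\<^sub>R x \<in> uniform_limits A"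
      using op[OF ops(3) lipschitz_op_scaleR] by simp
  qed (rule op[OF ops(2) lipschitz_op_add] op[OF ops(4) lipschitz_op_lattice(1)]
         op[OF ops(5) lipschitz_op_lattice(2)]; simp)+
qed

section \<open>Monotonicity and minimality of the stages\<close>

lemma Field_Restr_underS: "Well_order r \<Longrightarrow> Field (Restr r (underS r b)) = underS r b"
  by (intro Field_Restr_ofilter wo_rel.underS_ofilter) (auto simp: wo_rel_def)

text \<open>Initial segments of initial segments are initial segments of the whole, so facts about
  \<open>?s\<close> in the inductions below can be read as facts about \<open>r\<close>.\<close>

lemma Restr_underS_Restr_underS:
  assumes r: "Well_order r" and ab: "a \<in> underS r b"
  shows "Restr (Restr r (underS r b)) (underS (Restr r (underS r b)) a) = Restr r (underS r a)"
proof -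
  have sub: "underS r a \<subseteq> underS r b"
    using r ab by (auto simp: order_on_defs underS_def dest: antisymD transD)
  then have "underS (Restr r (underS r b)) a = underS r a"
    using ab by (auto simp: underS_def)
  then show ?thesis using sub by auto
qed

text \<open>Membership of 0 makes it available as the regulator of constant sequences, so that
  successor steps do not lose elements.\<close>

lemma stage_superset:
  assumes r: "Well_order r" and "0 \<in> X"
  shows "X \<subseteq> stage X r"
  using r
proof (induction r rule: wf_induct_rule[OF wf_ordLess])
  case (1 r)
  have IH: "X \<subseteq> stage X (Restr r (underS r a))" if "a \<in> Field r" for a
    using that 1(2) by (intro 1(1) underS_Restr_ordLess Well_order_Restr) auto
  consider "Field r = {}" | m where "is_greatest r m" | "Field r \<noteq> {}" "\<nexists>m. is_greatest r m"
    by blast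
  then show ?case
  proof cases
    case 1
    then show ?thesis by (simp add: stage.simps)
  next
    case 2
    then show ?thesis
      using stage_succ[OF 1(2) 2] IH[of m] uniform_limits_superset \<open>0 \<in> X\<close> by blast
  next
    case 3
    then show ?thesis using stage_limit[OF 1(2) 3] IH by blast
  qed
qed

text \<open>Transfinite induction using that \<open>uniform_limits\<close> is monotone. As
  \<open>V\<close> is an arbitrary set, the lemma serves as an induction principle: \<open>V\<close>
  is later the domain of a relation and a preimage.\<close>

lemma stage_least:
  assumes "Well_order r" and XV: "X \<subseteq> V" and V: "uniform_limits V \<subseteq> V"
  shows "stage X r \<subseteq> V"
  using assms(1)
proof (induction r rule: wf_induct_rule[OF wf_ordLess])
  case (1 r)
  have IH: "stage X (Restr r (underS r a)) \<subseteq> V" if "a \<in> Field r" for a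
    using that 1(2) by (intro 1(1) underS_Restr_ordLess Well_order_Restr) auto
  consider "Field r = {}" | m where "is_greatest r m" | "Field r \<noteq> {}" "\<nexists>m. is_greatest r m"
    by blast
  then show ?case
  proof cases
    case 1
    then show ?thesis using XV by (simp add: stage.simps)
  next
    case 2
    then show ?thesis
      using stage_succ[OF 1(2) 2] uniform_limits_mono[OF IH[of m]] V by blast
  next
    case 3
    then show ?thesis using stage_limit[OF 1(2) 3] IH by blast
  qed
qed

text \<open>Only the successor case needs induction: an element \<open>a\<close> other than the
  greatest element \<open>m\<close> lies below \<open>m\<close>, so its stage is contained in that
  of the predecessor, which the last step enlarges.\<close>

lemma stage_segment_subset:
  assumes r: "Well_order r" and "0 \<in> X" and "a \<in> Field r"
  shows "stage X (Restr r (underS r a)) \<subseteq> stage X r"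
  using assms(1,3)
proof (induction r rule: wf_induct_rule[OF wf_ordLess])
  case (1 r)
  show ?case
  proof (cases "\<exists>m. is_greatest r m")
    case True
    then obtain m where m: "is_greatest r m" by blast
    let ?s = "Restr r (underS r m)"
    have s: "Well_order ?s" using 1(2) by (rule Well_order_Restr)
    have step: "stage X ?s \<subseteq> stage X r"
      unfolding stage_succ[OF 1(2) m]
      using stage_superset[OF s \<open>0 \<in> X\<close>] \<open>0 \<in> X\<close> by (intro uniform_limits_superset) blast
    show ?thesis
    proof (cases "a = m")
      case False
      then have a: "a \<in> underS r m" using m 1(3) by (auto simp: underS_def)
      have "stage X (Restr ?s (underS ?s a)) \<subseteq> stage X ?s"
        using 1(2) m a s
        by (intro 1(1) underS_Restr_ordLess) (auto simp: Field_Restr_underS)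
      then show ?thesis using step by (simp only: Restr_underS_Restr_underS[OF 1(2) a])
    qed (use step in simp)
  next
    case False
    then show ?thesis using stage_limit[OF 1(2) _ False] 1(3) by blast
  qed
qed

text \<open>Ordinals on different carrier types are compared: the smaller one is isomorphic to the
  larger one or to a segment of it, and \<open>stage_ordIso\<close> makes the carrier
  irrelevant.\<close>

lemma stage_mono:
  fixes r :: "'o rel" and r' :: "'p rel"
  assumes le: "(r, r') \<in> ordLeq" and "0 \<in> X"
  shows "stage X r \<subseteq> stage X r'"
proof -
  have wo: "Well_order r" "Well_order r'" using le by (auto simp: ordLeq_def)
  consider "(r, r') \<in> ordIso" | "(r, r') \<in> ordLess"
    using le ordLeq_iff_ordLess_or_ordIso by blast
  then show ?thesis
  proof cases
    case 1
    then show ?thesis using stage_ordIso[of r r' X] by simp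
  next
    case 2
    then obtain a where "a \<in> Field r'" "(r, Restr r' (underS r' a)) \<in> ordIso"
      using ordLess_iff_ordIso_Restr[OF wo(2,1)] by blast
    then show ?thesis
      using stage_ordIso[of r _ X] stage_segment_subset[OF wo(2) \<open>0 \<in> X\<close>] by blast
  qed
qed

lemma stage_segment_mono:
  assumes r: "Well_order r" and "0 \<in> X" and ab: "(a, b) \<in> r"
  shows "stage X (Restr r (underS r a)) \<subseteq> stage X (Restr r (underS r b))"
proof (cases "a = b")
  case False
  then have a: "a \<in> underS r b" using ab by (auto simp: underS_def)
  let ?s = "Restr r (underS r b)"
  have "stage X (Restr ?s (underS ?s a)) \<subseteq> stage X ?s"
    using r a \<open>0 \<in> X\<close> by (intro stage_segment_subset Well_order_Restr)
      (auto simp: Field_Restr_underS)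
  then show ?thesis by (simp only: Restr_underS_Restr_underS[OF r a])
qed simp

section \<open>Countable subsets of the first uncountable ordinal\<close>

lemma Well_order_total:
  assumes "Well_order r" "a \<in> Field r" "b \<in> Field r"
  shows "(a, b) \<in> r \<or> b \<in> underS r a"
  using assms wo_rel.TOTALS[of r] by (auto simp: wo_rel_def underS_def)

text \<open>If \<open>S\<close> had no strict upper bound, the closed segments below its elements
  would cover \<open>omega1\<close>, a countable union of countable sets.\<close>

lemma omega1_countable_bounded:
  assumes S: "countable S" "S \<subseteq> Field omega1"
  obtains c where "c \<in> Field omega1" "S \<subseteq> underS omega1 c"
proof -
  have "\<exists>c\<in>Field omega1. S \<subseteq> underS omega1 c"
  proof (rule ccontr)
    assume no: "\<not> ?thesis"
    have "Field omega1 \<subseteq> (\<Union>s\<in>S. insert s (underS omega1 s))"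
    proof
      fix c assume c: "c \<in> Field omega1"
      then obtain s where s: "s \<in> S" "s \<notin> underS omega1 c" using no by blast
      then have "(c, s) \<in> omega1"
        using Well_order_total[OF omega1_first_uncountable(1) c] Well_order_total[OF omega1_first_uncountable(1) _ c] S(2)
        by (metis subsetD)
      then show "c \<in> (\<Union>s\<in>S. insert s (underS omega1 s))"
        using s(1) by (auto simp: underS_def)
    qed
    moreover have "countable (\<Union>s\<in>S. insert s (underS omega1 s))"
      using S omega1_first_uncountable(3) by (intro countable_UN countable_insert) auto
    ultimately show False using omega1_first_uncountable(2) countable_subset by blast
  qed
  then show ?thesis using that by blast
qed

lemma underS_antisym:
  assumes "Well_order r" "a \<in> underS r b" "(b, a) \<in> r"
  shows False
  using assms by (auto simp: order_on_defs underS_def dest: antisymD)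

text \<open>A greatest element \<open>m\<close> is impossible because the countable set
  \<open>{m}\<close> has a strict upper bound.\<close>

lemma stage_omega1_eq:
  "stage X omega1 = (\<Union>a\<in>Field omega1. stage X (Restr omega1 (underS omega1 a)))"
proof (rule stage_limit[OF omega1_first_uncountable(1)])
  show "Field omega1 \<noteq> {}" using omega1_first_uncountable(2) by auto
  show "\<nexists>m. is_greatest omega1 m"
  proof
    assume "\<exists>m. is_greatest omega1 m"
    then obtain m where m: "is_greatest omega1 m" by blast
    then obtain c where "c \<in> Field omega1" "{m} \<subseteq> underS omega1 c"
      using omega1_countable_bounded[of "{m}"] by auto
    then show False using m underS_antisym[OF omega1_first_uncountable(1), of m c] by blast
  qed
qed

lemma stage_omega1_countable:
  assumes "0 \<in> X" "countable S" "S \<subseteq> stage X omega1"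
  obtains c where "c \<in> Field omega1" "S \<subseteq> stage X (Restr omega1 (underS omega1 c))"
proof -
  have "\<forall>s\<in>S. \<exists>a\<in>Field omega1. s \<in> stage X (Restr omega1 (underS omega1 a))"
    using assms(3) unfolding stage_omega1_eq by blast
  then obtain a where a: "\<And>s. s \<in> S \<Longrightarrow> a s \<in> Field omega1"
    "\<And>s. s \<in> S \<Longrightarrow> s \<in> stage X (Restr omega1 (underS omega1 (a s)))"
    by metis
  obtain c where c: "c \<in> Field omega1" "a ` S \<subseteq> underS omega1 c"
    using omega1_countable_bounded[of "a ` S"] assms(2) a(1) by auto
  have "s \<in> stage X (Restr omega1 (underS omega1 c))" if "s \<in> S" for s
  proof -
    have "(a s, c) \<in> omega1" using c(2) that by (auto simp: underS_def)
    then show ?thesis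
      using stage_segment_mono[OF omega1_first_uncountable(1) assms(1)] a(2)[OF that] by blast
  qed
  then show ?thesis using that c(1) by blast
qed

text \<open>A sequence together with its regulator is a countable set, hence lies in a single stage
  indexed by some \<open>c\<close>. The limit appears one stage later, still below
  \<open>omega1\<close>.\<close>

lemma stage_omega1_closed:
  assumes "0 \<in> X"
  shows "uniform_limits (stage X omega1) \<subseteq> stage X omega1"
proof
  let ?r = omega1
  note wo = omega1_first_uncountable(1)
  fix z assume "z \<in> uniform_limits (stage X ?r)"
  then obtain x e where x: "\<And>n. x n \<in> stage X ?r" "e \<in> stage X ?r" "0 \<le> e" "seq_conv x z e"
    unfolding uniform_limits_def by blast
  obtain c where c: "c \<in> Field ?r" "insert e (range x) \<subseteq> stage X (Restr ?r (underS ?r c))"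
    using x by (auto intro: stage_omega1_countable[OF assms, of "insert e (range x)"])
  then have z: "z \<in> uniform_limits (stage X (Restr ?r (underS ?r c)))"
    using x unfolding uniform_limits_def by blast
  \<comment> \<open>The least element \<open>b\<close> of \<open>?B\<close> is the successor of
    \<open>c\<close>: by minimality \<open>c\<close> is greatest in the segment below
    \<open>b\<close>.\<close>
  let ?B = "{b. c \<in> underS ?r b}"
  obtain b0 where "b0 \<in> ?B" using omega1_countable_bounded[of "{c}"] c(1) by auto
  moreover have "wf (?r - Id)" using wo by (simp add: order_on_defs)
  ultimately obtain b where b: "b \<in> ?B" "\<And>y. (y, b) \<in> ?r - Id \<Longrightarrow> y \<notin> ?B"
    using wfE_min[of "?r - Id" b0 ?B] by blast
  have cb: "c \<in> underS ?r b" using b(1) by simp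
  have bF: "b \<in> Field ?r" using cb by (auto simp: underS_def Field_def)
  have "(a, c) \<in> ?r" if "a \<in> underS ?r b" for a
  proof -
    have "a \<in> Field ?r" "c \<notin> underS ?r a"
      using that b(2)[of a] by (auto simp: underS_def Field_def)
    then show ?thesis using Well_order_total[OF wo _ c(1)] by blast
  qed
  then have "is_greatest (Restr ?r (underS ?r b)) c"
    using cb by (auto simp: Field_Restr_underS[OF wo])
  from stage_succ[OF Well_order_Restr[OF wo] this, of X]
  have "stage X (Restr ?r (underS ?r b)) = uniform_limits (stage X (Restr ?r (underS ?r c)))"
    by (simp only: Restr_underS_Restr_underS[OF wo cb])
  then show "z \<in> stage X ?r" using z stage_segment_subset[OF wo assms bF] by blast
qed

lemma vector_sublattice_stage:
  assumes r: "Well_order r" and X: "vector_sublattice X"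
  shows "vector_sublattice (stage X r)"
  using r
proof (induction r rule: wf_induct_rule[OF wf_ordLess])
  case (1 r)
  note wo = 1(2)
  have zero: "0 \<in> X" using X by (simp add: vector_sublattice_def subspace_def)
  have IH: "vector_sublattice (stage X (Restr r (underS r a)))" if "a \<in> Field r" for a
    using that 1(2) by (intro 1(1) underS_Restr_ordLess Well_order_Restr) auto
  consider "Field r = {}" | m where "is_greatest r m" | "Field r \<noteq> {}" "\<nexists>m. is_greatest r m"
    by blast
  then show ?case
  proof cases
    case 1
    then show ?thesis using X by (simp add: stage.simps)
  next
    case 2
    then show ?thesis
      unfolding stage_succ[OF wo 2] by (intro vector_sublattice_uniform_limits IH) simp
  next
    case 3
    note eq = stage_limit[OF wo 3, of X]
    \<comment> \<open>A limit stage is a union of a chain, so two of its elements can be combined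
      inside one earlier stage.\<close>
    have common: "\<exists>c\<in>Field r. u \<in> stage X (Restr r (underS r c)) \<and> v \<in> stage X (Restr r (underS r c))"
      if uv: "u \<in> stage X r" "v \<in> stage X r" for u v
    proof -
      obtain a b where ab: "a \<in> Field r" "b \<in> Field r"
        "u \<in> stage X (Restr r (underS r a))" "v \<in> stage X (Restr r (underS r b))"
        using uv unfolding eq by blast
      have "(a, b) \<in> r \<or> (b, a) \<in> r"
        using Well_order_total[OF wo ab(1,2)] by (auto simp: underS_def)
      then show ?thesis using ab stage_segment_mono[OF wo zero] by blast
    qed
    have up: "w \<in> stage X r" if "c \<in> Field r" "w \<in> stage X (Restr r (underS r c))" for w c
      using that unfolding eq by blast
    have z: "0 \<in> stage X r" using stage_superset[OF wo zero] zero by blast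
    have "u + v \<in> stage X r \<and> k *\<^sub>R u \<in> stage X r \<and> sup u v \<in> stage X r \<and> inf u v \<in> stage X r"
      if uv: "u \<in> stage X r" "v \<in> stage X r" for u v k
    proof -
      obtain c where c: "c \<in> Field r" "u \<in> stage X (Restr r (underS r c))"
        "v \<in> stage X (Restr r (underS r c))"
        using common[OF uv] by blast
      show ?thesis
        using IH[OF c(1)] c(2,3) by (auto simp: vector_sublattice_def subspace_def intro!: up[OF c(1)])
    qed
    with z show ?thesis by (auto simp: vector_sublattice_def subspace_def)
  qed
qed


section \<open>Extending an injective lattice homomorphism\<close>

text \<open>
  Graphs of injective lattice homomorphisms: the last clause, applied to differences, makes the
  relation both single-valued and injective.
\<close>

definition lattice_graph ::
  "('a::archimedean_vector_lattice \<times> 'b::archimedean_vector_lattice) set \<Rightarrow> bool" where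
  "lattice_graph H \<longleftrightarrow> (0, 0) \<in> H \<and>
     (\<forall>a b c d. (a, b) \<in> H \<longrightarrow> (c, d) \<in> H \<longrightarrow>
        (a + c, b + d) \<in> H \<and> (sup a c, sup b d) \<in> H \<and> (inf a c, inf b d) \<in> H) \<and>
     (\<forall>k a b. (a, b) \<in> H \<longrightarrow> (k *\<^sub>R a, k *\<^sub>R b) \<in> H) \<and>
     (\<forall>a b. (a, b) \<in> H \<longrightarrow> (a = 0 \<longleftrightarrow> b = 0))"

section \<open>Transfer of order and convergence along a graph\<close>

lemma lattice_graphD:
  assumes "lattice_graph H"
  shows "(0, 0) \<in> H"
    and "(a, b) \<in> H \<Longrightarrow> (c, d) \<in> H \<Longrightarrow> (a + c, b + d) \<in> H"
    and "(a, b) \<in> H \<Longrightarrow> (c, d) \<in> H \<Longrightarrow> (sup a c, sup b d) \<in> H"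
    and "(a, b) \<in> H \<Longrightarrow> (c, d) \<in> H \<Longrightarrow> (inf a c, inf b d) \<in> H"
    and "(a, b) \<in> H \<Longrightarrow> (k *\<^sub>R a, k *\<^sub>R b) \<in> H"
    and "(a, b) \<in> H \<Longrightarrow> a = 0 \<longleftrightarrow> b = 0"
  using assms unfolding lattice_graph_def by blast+

lemma lattice_graph_diff:
  assumes "lattice_graph H" "(a, b) \<in> H" "(c, d) \<in> H"
  shows "(a - c, b - d) \<in> H"
  using lattice_graphD(2)[OF assms(1,2) lattice_graphD(5)[OF assms(1,3), of "- 1"]] by simp

lemma lattice_graph_abs:
  assumes "lattice_graph H" "(a, b) \<in> H"
  shows "(\<bar>a\<bar>, \<bar>b\<bar>) \<in> H"
  using lattice_graphD(3)[OF assms lattice_graphD(5)[OF assms, of "- 1"]] by (simp add: abs_lattice)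

text \<open>The relation \<open>a \<le> c\<close> says that \<open>sup a c - c\<close> vanishes, and
  vanishing passes between the coordinates by the last clause of
  \<open>lattice_graph\<close>.\<close>

lemma lattice_graph_le_iff:
  assumes "lattice_graph H" "(a, b) \<in> H" "(c, d) \<in> H"
  shows "a \<le> c \<longleftrightarrow> b \<le> d"
proof -
  have "(sup a c - c, sup b d - d) \<in> H"
    using assms by (intro lattice_graph_diff lattice_graphD(3))
  from lattice_graphD(6)[OF assms(1) this] show ?thesis
    by (simp add: sup.absorb_iff2)
qed

lemma lattice_graph_eq_iff:
  assumes "lattice_graph H" "(a, b) \<in> H" "(c, d) \<in> H"
  shows "a = c \<longleftrightarrow> b = d"
  using lattice_graphD(6)[OF assms(1) lattice_graph_diff[OF assms]] by simp

lemma lattice_graph_abs_diff_le_iff: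
  assumes "lattice_graph H" "(a, b) \<in> H" "(c, d) \<in> H" "(e, f) \<in> H"
  shows "\<bar>a - c\<bar> \<le> \<epsilon> *\<^sub>R e \<longleftrightarrow> \<bar>b - d\<bar> \<le> \<epsilon> *\<^sub>R f"
  using assms by (intro lattice_graph_le_iff[of H] lattice_graph_abs lattice_graph_diff lattice_graphD(5))

text \<open>Each inequality in the definition of convergence compares elements of the graph, so it
  transfers. The candidate limits have to be paired by \<open>H\<close> themselves.\<close>

lemma lattice_graph_seq_conv_iff:
  assumes "lattice_graph H" "\<And>n. (x n, y n) \<in> H" "(z, d) \<in> H" "(e, f) \<in> H"
  shows "seq_conv x z e \<longleftrightarrow> seq_conv y d f"
proof -
  have "\<bar>x n - z\<bar> \<le> \<epsilon> *\<^sub>R e \<longleftrightarrow> \<bar>y n - d\<bar> \<le> \<epsilon> *\<^sub>R f" for n \<epsilon>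
    using assms by (intro lattice_graph_abs_diff_le_iff)
  then show ?thesis by (simp add: converges_rel_def)
qed

text \<open>No limit enters here, so this version can be used on a side where a limit is yet to be
  found.\<close>

lemma lattice_graph_seq_Cauchy_iff:
  assumes "lattice_graph H" "\<And>n. (x n, y n) \<in> H" "(e, f) \<in> H"
  shows "seq_Cauchy x e \<longleftrightarrow> seq_Cauchy y f"
proof -
  have "\<bar>x m - x n\<bar> \<le> \<epsilon> *\<^sub>R e \<longleftrightarrow> \<bar>y m - y n\<bar> \<le> \<epsilon> *\<^sub>R f" for m n \<epsilon>
    using assms by (intro lattice_graph_abs_diff_le_iff)
  then show ?thesis by (simp add: seq_Cauchy_def)
qed

section \<open>Closing a graph under limits\<close>

definition graph_limits ::
  "('a::archimedean_vector_lattice \<times> 'b::archimedean_vector_lattice) set \<Rightarrow> ('a \<times> 'b) set" where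
  "graph_limits H = {(z, d). \<exists>x y e f. (\<forall>n. (x n, y n) \<in> H) \<and> (e, f) \<in> H \<and> 0 \<le> e \<and> 0 \<le> f \<and>
     seq_conv x z e \<and> seq_conv y d f}"

lemma graph_limits_iff:
  "(z, d) \<in> graph_limits H \<longleftrightarrow> (\<exists>x y e f. (\<forall>n. (x n, y n) \<in> H) \<and> (e, f) \<in> H \<and> 0 \<le> e \<and> 0 \<le> f \<and>
     seq_conv x z e \<and> seq_conv y d f)"
  by (simp add: graph_limits_def)

text \<open>Operations that correspond under \<open>H\<close> are applied to both coordinates of the
  two sequences of pairs, and the regulators are added as pairs.\<close>

lemma graph_limits_op:
  assumes "\<And>a b c d. (a, b) \<in> H \<Longrightarrow> (c, d) \<in> H \<Longrightarrow> (f a c, g b d) \<in> H" "lattice_graph H"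
    and "lipschitz_op K f" "lipschitz_op K g" "K \<ge> 0"
    and u: "(a, b) \<in> graph_limits H" and v: "(c, d) \<in> graph_limits H"
  shows "(f a c, g b d) \<in> graph_limits H"
proof -
  obtain x y p q where x: "\<And>n. (x n, y n) \<in> H" "(p, q) \<in> H" "0 \<le> p" "0 \<le> q"
      "seq_conv x a p" "seq_conv y b q"
    using u by (auto simp: graph_limits_iff)
  obtain x' y' p' q' where x': "\<And>n. (x' n, y' n) \<in> H" "(p', q') \<in> H" "0 \<le> p'" "0 \<le> q'"
      "seq_conv x' c p'" "seq_conv y' d q'"
    using v by (auto simp: graph_limits_iff)
  have "seq_conv (\<lambda>n. f (x n) (x' n)) (f a c) (p + p')"
    "seq_conv (\<lambda>n. g (y n) (y' n)) (g b d) (q + q')"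
    using x x' assms by (auto intro: seq_conv_op)
  moreover have "\<forall>n. (f (x n) (x' n), g (y n) (y' n)) \<in> H" using x x' assms(1) by blast
  moreover have "(p + p', q + q') \<in> H" using x x' assms(2) by (intro lattice_graphD(2))
  moreover have "0 \<le> p + p'" "0 \<le> q + q'" using x x' by simp_all
  ultimately show ?thesis unfolding graph_limits_iff by (intro exI conjI)
qed

lemma graph_limits_superset:
  assumes "lattice_graph H"
  shows "H \<subseteq> graph_limits H"
proof (rule subrelI)
  fix z d assume "(z, d) \<in> H"
  then show "(z, d) \<in> graph_limits H"
    unfolding graph_limits_iff using lattice_graphD(1)[OF assms] seq_conv_const[of z] seq_conv_const[of d]
    by (intro exI[of _ "\<lambda>_. z"] exI[of _ "\<lambda>_. d"] exI[of _ 0]) auto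
qed

lemma lattice_graph_graph_limits:
  assumes H: "lattice_graph H"
  shows "lattice_graph (graph_limits H)"
proof -
  have "z = 0 \<longleftrightarrow> d = 0" if zd: "(z, d) \<in> graph_limits H" for z d
  proof -
    obtain x y e f where x: "\<And>n. (x n, y n) \<in> H" "(e, f) \<in> H" "0 \<le> e" "0 \<le> f"
        "seq_conv x z e" "seq_conv y d f"
      using zd by (auto simp: graph_limits_iff)
    \<comment> \<open>The pair \<open>(z, d)\<close> need not belong to \<open>H\<close>, but
      \<open>(0, 0)\<close> does, so convergence to 0 transfers. Uniqueness of limits turns this
      into the statement on \<open>z\<close> and \<open>d\<close>.\<close>
    have iff: "seq_conv x 0 e \<longleftrightarrow> seq_conv y 0 f"
      using H x lattice_graphD(1)[OF H] by (intro lattice_graph_seq_conv_iff)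
    have "seq_conv x 0 e \<longleftrightarrow> z = 0"
      using x(5) seq_conv_unique[OF x(5) _ x(3) x(3), of 0] by blast
    moreover have "seq_conv y 0 f \<longleftrightarrow> d = 0"
      using x(6) seq_conv_unique[OF x(6) _ x(4) x(4), of 0] by blast
    ultimately show ?thesis using iff by simp
  qed
  then show ?thesis
    unfolding lattice_graph_def
  proof (intro conjI allI impI)
    show "(0, 0) \<in> graph_limits H" using graph_limits_superset[OF H] lattice_graphD(1)[OF H] by blast
  next
    fix k a b assume "(a, b) \<in> graph_limits H"
    then show "(k *\<^sub>R a, k *\<^sub>R b) \<in> graph_limits H"
      using graph_limits_op[OF lattice_graphD(5)[OF H] H lipschitz_op_scaleR lipschitz_op_scaleR]
      by simp
  qed (rule graph_limits_op[OF lattice_graphD(2)[OF H] H lipschitz_op_add lipschitz_op_add]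
      graph_limits_op[OF lattice_graphD(3)[OF H] H lipschitz_op_lattice(1) lipschitz_op_lattice(1)]
      graph_limits_op[OF lattice_graphD(4)[OF H] H lipschitz_op_lattice(2) lipschitz_op_lattice(2)];
      simp)+
qed

section \<open>Maximal graphs by Zorn's lemma\<close>

lemma lattice_graph_Union_chain:
  assumes "subset.chain {H. lattice_graph H} C" "C \<noteq> {}"
  shows "lattice_graph (\<Union>C)"
proof -
  have C: "\<And>H. H \<in> C \<Longrightarrow> lattice_graph H" "\<And>H K. H \<in> C \<Longrightarrow> K \<in> C \<Longrightarrow> H \<subseteq> K \<or> K \<subseteq> H"
    using assms(1) by (auto simp: subset_chain_def)
  have common: "\<exists>H\<in>C. p \<in> H \<and> q \<in> H" if "p \<in> \<Union>C" "q \<in> \<Union>C" for p q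
    using that C(2) by blast
  show ?thesis
    unfolding lattice_graph_def
  proof (intro conjI allI impI)
    show "(0, 0) \<in> \<Union>C" using assms(2) C(1) lattice_graphD(1) by blast
  next
    fix a b c d assume "(a, b) \<in> \<Union>C" "(c, d) \<in> \<Union>C"
    then obtain H where "H \<in> C" "(a, b) \<in> H" "(c, d) \<in> H" using common by blast
    then show "(a + c, b + d) \<in> \<Union>C" "(sup a c, sup b d) \<in> \<Union>C" "(inf a c, inf b d) \<in> \<Union>C"
      using lattice_graphD[OF C(1)] by blast+
  next
    fix k a b assume "(a, b) \<in> \<Union>C"
    then show "(k *\<^sub>R a, k *\<^sub>R b) \<in> \<Union>C" using lattice_graphD(5)[OF C(1)] by blast
  next
    fix a b assume "(a, b) \<in> \<Union>C"
    then show "a = 0 \<longleftrightarrow> b = 0" using lattice_graphD(6)[OF C(1)] by blast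
  qed
qed

text \<open>For a maximal graph \<open>M\<close> above \<open>H\<^sub>0\<close>, the set
  \<open>graph_limits M\<close> is again a lattice graph containing \<open>M\<close>, hence equal to
  \<open>M\<close>.\<close>

lemma lattice_graph_extends_to_limit_closed:
  assumes "lattice_graph H\<^sub>0"
  obtains H where "H\<^sub>0 \<subseteq> H" "lattice_graph H" "graph_limits H \<subseteq> H"
proof -
  let ?A = "{H. lattice_graph H \<and> H\<^sub>0 \<subseteq> H}"
  have "\<exists>M\<in>?A. \<forall>H\<in>?A. M \<subseteq> H \<longrightarrow> H = M"
  proof (rule subset_Zorn_nonempty)
    fix C assume C: "C \<noteq> {}" "subset.chain ?A C"
    then have "subset.chain {H. lattice_graph H} C" by (auto simp: subset_chain_def)
    then show "\<Union>C \<in> ?A"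
      using C lattice_graph_Union_chain by (auto simp: subset_chain_def)
  qed (use assms in blast)
  then obtain M where M: "lattice_graph M" "H\<^sub>0 \<subseteq> M"
    and max: "\<forall>H\<in>?A. M \<subseteq> H \<longrightarrow> H = M"
    by auto
  have "graph_limits M = M"
    using M graph_limits_superset[OF M(1)]
      lattice_graph_graph_limits[OF M(1)]
    by (intro max[rule_format]) auto
  then show ?thesis by (intro that[OF M(2,1)]) simp
qed

lemma lattice_graph_of_hom:
  assumes X: "vector_sublattice X" and j: "vector_lattice_hom_on X j" "inj_on j X"
  shows "lattice_graph ((\<lambda>x. (x, j x)) ` X)"
proof -
  have ops: "0 \<in> X" "\<And>a b. a \<in> X \<Longrightarrow> b \<in> X \<Longrightarrow> a + b \<in> X" "\<And>c a. a \<in> X \<Longrightarrow> c *\<^sub>R a \<in> X"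
    "\<And>a b. a \<in> X \<Longrightarrow> b \<in> X \<Longrightarrow> sup a b \<in> X" "\<And>a b. a \<in> X \<Longrightarrow> b \<in> X \<Longrightarrow> inf a b \<in> X"
    using X by (auto simp: vector_sublattice_def subspace_def)
  have hom: "\<And>a b. a \<in> X \<Longrightarrow> b \<in> X \<Longrightarrow> j (a + b) = j a + j b"
    "\<And>c a. a \<in> X \<Longrightarrow> j (c *\<^sub>R a) = c *\<^sub>R j a"
    "\<And>a b. a \<in> X \<Longrightarrow> b \<in> X \<Longrightarrow> j (sup a b) = sup (j a) (j b)"
    "\<And>a b. a \<in> X \<Longrightarrow> b \<in> X \<Longrightarrow> j (inf a b) = inf (j a) (j b)"
    using j(1) by (auto simp: vector_lattice_hom_on_def)
  have j0: "j 0 = 0" using hom(2)[OF ops(1), of 0] by simp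
  then have "x = 0 \<longleftrightarrow> j x = 0" if "x \<in> X" for x
    using inj_onD[OF j(2) _ that ops(1)] by auto
  then show ?thesis
    unfolding lattice_graph_def using ops hom j0 by (auto simp: image_iff)
qed

text \<open>It suffices that \<open>Domain H\<close> is closed under uniform limits, since
  \<open>W\<close> is below every such set containing \<open>X\<close>. A convergent sequence in the
  domain has a Cauchy partner, completeness of the codomain gives a limit \<open>d\<close>, and the
  limit pair lies in \<open>H\<close>.\<close>

theorem injective_hom_extends_to_limit_closed:
  fixes j :: "'a::archimedean_vector_lattice \<Rightarrow> 'b::archimedean_vector_lattice"
  assumes X: "vector_sublattice X" and j: "vector_lattice_hom_on X j" "inj_on j X"
    and D: "seq_complete (UNIV :: 'b set)"
    and W: "\<And>V. X \<subseteq> V \<Longrightarrow> uniform_limits V \<subseteq> V \<Longrightarrow> W \<subseteq> V"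
  shows "\<exists>\<Phi> H. lattice_graph H \<and> (\<forall>x\<in>X. \<Phi> x = j x) \<and> (\<forall>w\<in>W. (w, \<Phi> w) \<in> H)"
proof -
  obtain H where sub: "(\<lambda>x. (x, j x)) ` X \<subseteq> H" and H: "lattice_graph H" "graph_limits H \<subseteq> H"
    using lattice_graph_extends_to_limit_closed[OF lattice_graph_of_hom[OF X j]] .
  have "uniform_limits (Domain H) \<subseteq> Domain H"
  proof
    fix z assume "z \<in> uniform_limits (Domain H)"
    then obtain x e where x: "\<And>n. x n \<in> Domain H" "e \<in> Domain H" "0 \<le> e" "seq_conv x z e"
      unfolding uniform_limits_def by blast
    obtain y where y: "\<And>n. (x n, y n) \<in> H" using x(1) choice[of "\<lambda>n d. (x n, d) \<in> H"] by (auto simp: Domain_iff)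
    obtain f where f: "(e, f) \<in> H" using x(2) by blast
    have f0: "0 \<le> f" using lattice_graph_le_iff[OF H(1) lattice_graphD(1)[OF H(1)] f] x(3) by simp
    have "seq_Cauchy y f"
      using lattice_graph_seq_Cauchy_iff[OF H(1) y f] seq_conv_imp_Cauchy[OF x(4)] by simp
    then obtain d where "seq_conv y d f" using seq_completeD[OF D _ _ f0, of y] by auto
    then have "(z, d) \<in> graph_limits H"
      unfolding graph_limits_iff using y f f0 x(3,4) by blast
    then show "z \<in> Domain H" using H(2) by blast
  qed
  moreover have "X \<subseteq> Domain H" using sub by blast
  ultimately have "W \<subseteq> Domain H" using W by blast
  \<comment> \<open>On \<open>Domain H\<close> the choice is forced because \<open>H\<close> is
    single-valued; elsewhere the value is arbitrary.\<close>
  define \<Phi> where "\<Phi> z = (SOME d. (z, d) \<in> H)" for z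
  have \<Phi>: "(z, \<Phi> z) \<in> H" if "z \<in> Domain H" for z
    unfolding \<Phi>_def using that by (auto intro: someI)
  have "\<Phi> x = j x" if "x \<in> X" for x
  proof -
    have xj: "(x, j x) \<in> H" using sub that by blast
    have "(x, \<Phi> x) \<in> H" using xj by (intro \<Phi>) blast
    from lattice_graph_eq_iff[OF H(1) xj this] show ?thesis by simp
  qed
  moreover have "(w, \<Phi> w) \<in> H" if "w \<in> W" for w
    using \<Phi> subsetD[OF \<open>W \<subseteq> Domain H\<close> that] .
  ultimately show ?thesis using H(1) by blast
qed


section \<open>The uniform completion\<close>

theorem mainTheorem4:
  fixes X :: "'z::archimedean_vector_lattice set"
    and j :: "'z \<Rightarrow> 'd::{archimedean_vector_lattice, conditionally_complete_lattice}"
  assumes "uniformly_complete (UNIV :: 'z set)"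
    and "vector_sublattice X"
    and "order_completion X j"
  shows "(\<forall>\<kappa> :: 'o rel. Well_order \<kappa> \<longrightarrow> (omega1, \<kappa>) \<in> ordLeq \<longrightarrow> stage X \<kappa> = stage X omega1) \<and>
         vector_sublattice (stage X omega1) \<and>
         (\<exists>\<Phi>. vector_lattice_iso \<Phi> (stage X omega1) (uniform_completion X j) \<and>
               (\<forall>x\<in>X. \<Phi> x = j x))"
proof (intro conjI)
  define W where "W = stage X omega1"
  note wo = omega1_first_uncountable(1)
  have zero: "0 \<in> X" using assms(2) by (simp add: vector_sublattice_def subspace_def)
  have XW: "X \<subseteq> W" unfolding W_def by (rule stage_superset[OF wo zero])
  have WW: "uniform_limits W \<subseteq> W" unfolding W_def by (rule stage_omega1_closed[OF zero])
  have least: "W \<subseteq> V" if "X \<subseteq> V" "uniform_limits V \<subseteq> V" for V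
    unfolding W_def by (rule stage_least[OF wo that])
  \<comment> \<open>Minimality with \<open>V = W\<close> bounds every later stage above by
    \<open>W\<close>; monotonicity gives the reverse inclusion.\<close>
  show "\<forall>\<kappa> :: 'o rel. Well_order \<kappa> \<longrightarrow> (omega1, \<kappa>) \<in> ordLeq \<longrightarrow> stage X \<kappa> = stage X omega1"
    using stage_least[OF _ XW WW] stage_mono[OF _ zero] unfolding W_def by blast
  have sub: "vector_sublattice W" unfolding W_def by (rule vector_sublattice_stage[OF wo assms(2)])
  then show "vector_sublattice (stage X omega1)" by (simp add: W_def)
  have j: "vector_lattice_hom_on X j" "inj_on j X"
    using assms(3) by (simp_all add: order_completion_def)
  obtain \<Phi> H where H: "lattice_graph H" and \<Phi>j: "\<And>x. x \<in> X \<Longrightarrow> \<Phi> x = j x"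
    and \<Phi>: "\<And>w. w \<in> W \<Longrightarrow> (w, \<Phi> w) \<in> H"
    using injective_hom_extends_to_limit_closed[OF assms(2) j seq_complete_Dedekind_complete least]
    by auto
  have ops: "0 \<in> W" "\<And>a b. a \<in> W \<Longrightarrow> b \<in> W \<Longrightarrow> a + b \<in> W" "\<And>c a. a \<in> W \<Longrightarrow> c *\<^sub>R a \<in> W"
    "\<And>a b. a \<in> W \<Longrightarrow> b \<in> W \<Longrightarrow> sup a b \<in> W" "\<And>a b. a \<in> W \<Longrightarrow> b \<in> W \<Longrightarrow> inf a b \<in> W"
    using sub by (auto simp: vector_sublattice_def subspace_def)
  \<comment> \<open>Single-valuedness of \<open>H\<close> turns its closure properties into
    equations for \<open>\<Phi>\<close> on \<open>W\<close>.\<close>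
  have val: "\<Phi> w = d" if "w \<in> W" "(w, d) \<in> H" for w d
    using lattice_graph_eq_iff[OF H \<Phi>[OF that(1)] that(2)] by simp
  have hom: "\<And>a b. a \<in> W \<Longrightarrow> b \<in> W \<Longrightarrow> \<Phi> (a + b) = \<Phi> a + \<Phi> b"
    "\<And>c a. a \<in> W \<Longrightarrow> \<Phi> (c *\<^sub>R a) = c *\<^sub>R \<Phi> a"
    "\<And>a b. a \<in> W \<Longrightarrow> b \<in> W \<Longrightarrow> \<Phi> (sup a b) = sup (\<Phi> a) (\<Phi> b)"
    "\<And>a b. a \<in> W \<Longrightarrow> b \<in> W \<Longrightarrow> \<Phi> (inf a b) = inf (\<Phi> a) (\<Phi> b)"
    using val[OF ops(2) lattice_graphD(2)[OF H \<Phi> \<Phi>]] val[OF ops(3) lattice_graphD(5)[OF H \<Phi>]]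
      val[OF ops(4) lattice_graphD(3)[OF H \<Phi> \<Phi>]] val[OF ops(5) lattice_graphD(4)[OF H \<Phi> \<Phi>]]
    by simp_all
  have \<Phi>0: "\<Phi> 0 = 0" using val[OF ops(1) lattice_graphD(1)[OF H]] .
  have nonneg: "0 \<le> \<Phi> w \<longleftrightarrow> 0 \<le> w" if "w \<in> W" for w
    using lattice_graph_le_iff[OF H lattice_graphD(1)[OF H] \<Phi>[OF that]] by simp
  have inj: "inj_on \<Phi> W"
    using lattice_graph_eq_iff[OF H \<Phi> \<Phi>] by (intro inj_onI) blast
  have Z: "seq_complete (UNIV :: 'z set)"
    using assms(1) by (intro seq_complete_if_uniformly_complete)
      (auto simp: vector_sublattice_def)
  have "vector_sublattice (\<Phi> ` W)"
    unfolding vector_sublattice_def subspace_def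
  proof (intro conjI ballI allI)
    show "0 \<in> \<Phi> ` W" using \<Phi>0 ops(1) by (metis imageI)
  qed (use ops in \<open>auto simp flip: hom\<close>)
  moreover have "j ` X \<subseteq> \<Phi> ` W" using XW \<Phi>j by force
  moreover have "seq_complete (\<Phi> ` W)"
    unfolding seq_complete_def
  proof (intro allI impI)
    fix y f assume y: "\<forall>n. y n \<in> \<Phi> ` W" and f: "f \<in> \<Phi> ` W" "0 \<le> f" and C: "seq_Cauchy y f"
    obtain x where x: "\<And>n. x n \<in> W" "\<And>n. y n = \<Phi> (x n)"
      using y choice[of "\<lambda>n w. w \<in> W \<and> y n = \<Phi> w"] by (auto simp: image_iff)
    obtain e where e: "e \<in> W" "f = \<Phi> e" "0 \<le> e" using f nonneg by auto
    have xy: "\<And>n. (x n, y n) \<in> H" and ef: "(e, f) \<in> H" using x e \<Phi> by auto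
    have "seq_Cauchy x e" using lattice_graph_seq_Cauchy_iff[OF H xy ef] C by simp
    \<comment> \<open>Completeness of the ambient lattice yields the limit of the pulled back
      sequence, and closedness of \<open>W\<close> puts it into \<open>W\<close>.\<close>
    then obtain z where z: "seq_conv x z e" using seq_completeD[OF Z _ _ e(3), of x] by auto
    then have "z \<in> W" using WW x(1) e unfolding uniform_limits_def by blast
    from lattice_graph_seq_conv_iff[OF H xy \<Phi>[OF this] ef] have "seq_conv y (\<Phi> z) f"
      using z by simp
    with \<open>z \<in> W\<close> show "\<exists>l\<in>\<Phi> ` W. seq_conv y l f" by blast
  qed
  ultimately have "uniform_completion X j \<subseteq> \<Phi> ` W"
    unfolding uniform_completion_def
    by (intro Inter_lower CollectI conjI uniformly_complete_if_seq_complete)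
  moreover have "\<Phi> ` W \<subseteq> Y"
    if Y: "vector_sublattice Y" "j ` X \<subseteq> Y" "uniformly_complete Y" for Y
  proof -
    have Yc: "seq_complete Y" using Y by (intro seq_complete_if_uniformly_complete)
    \<comment> \<open>Minimality of \<open>W\<close> is applied to the preimage of \<open>Y\<close>.
      Its closedness follows since completeness of \<open>Y\<close> gives a limit of the image
      sequence inside \<open>Y\<close>, which must be \<open>\<Phi> z\<close> by uniqueness.\<close>
    have "W \<subseteq> {w \<in> W. \<Phi> w \<in> Y}"
    proof (rule least)
      show "X \<subseteq> {w \<in> W. \<Phi> w \<in> Y}" using XW \<Phi>j Y(2) by auto
      show "uniform_limits {w \<in> W. \<Phi> w \<in> Y} \<subseteq> {w \<in> W. \<Phi> w \<in> Y}"
      proof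
        fix z assume "z \<in> uniform_limits {w \<in> W. \<Phi> w \<in> Y}"
        then obtain x e where x: "\<And>n. x n \<in> W" "\<And>n. \<Phi> (x n) \<in> Y"
          and e: "e \<in> W" "\<Phi> e \<in> Y" "0 \<le> e" and z: "seq_conv x z e"
          unfolding uniform_limits_def by blast
        have zW: "z \<in> W" using WW x e z unfolding uniform_limits_def by blast
        have c: "seq_conv (\<lambda>n. \<Phi> (x n)) (\<Phi> z) (\<Phi> e)"
          using lattice_graph_seq_conv_iff[OF H \<Phi>[OF x(1)] \<Phi>[OF zW] \<Phi>[OF e(1)]] z by simp
        have e0: "0 \<le> \<Phi> e" using nonneg e by blast
        have "\<exists>l\<in>Y. seq_conv (\<lambda>n. \<Phi> (x n)) l (\<Phi> e)"
          using Yc x(2) e(2) e0 seq_conv_imp_Cauchy[OF c] by (rule seq_completeD)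
        then obtain l where l: "l \<in> Y" "seq_conv (\<lambda>n. \<Phi> (x n)) l (\<Phi> e)" by blast
        then have "\<Phi> z = l" using seq_conv_unique[OF c l(2) e0 e0] by simp
        then show "z \<in> {w \<in> W. \<Phi> w \<in> Y}" using l(1) zW by simp
      qed
    qed
    then show ?thesis by blast
  qed
  then have "\<Phi> ` W \<subseteq> uniform_completion X j" unfolding uniform_completion_def
    by (intro Inter_greatest) simp
  ultimately have "bij_betw \<Phi> W (uniform_completion X j)"
    using inj by (auto simp: bij_betw_def)
  moreover have "vector_lattice_hom_on W \<Phi>" using hom by (simp add: vector_lattice_hom_on_def)
  ultimately show "\<exists>\<Phi>. vector_lattice_iso \<Phi> (stage X omega1) (uniform_completion X j) \<and>
      (\<forall>x\<in>X. \<Phi> x = j x)"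
    unfolding vector_lattice_iso_def W_def using \<Phi>j by (intro exI[of _ \<Phi>]) simp
qed

end
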